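(* Let $G$ be a decorated tree. Then critical percolation on $G$ (i.e. Bernoulli bond percolation with parameter $p=p_c(G)$) almost surely has no infinite clusters.
   Context: Percolation. For a connected, locally finite infinite graph $G=(V,E)$ and $0\le p\le 1$, percolation on $G$ with parameter $p$ is the random subset of $E(G)$ (the open edges) in which each edge is open independently with probability $p$; its law is $\mathbb{P}_p$. A path is open if all its edges are open. The cluster of $o\in V(G)$ is the set $C(o)$ of vertices joined to $o$ by an open path. $p_c(G)=\inf\{p: \mathbb{P}_p(\text{there is an infinite cluster})=1\}$. Decorated trees. Let $T$ be a $(d+1)$-regular tree, $d\ge 2$. An end of $T$ is an equivalence class of rays (half-infinite simple paths), two rays being equivalent if they differ in only finitely many edges. Fix an end $\xi$ of $T$. Let $K=\{\alpha\in\operatorname{Aut}T:\alpha\xi=\xi\}$, and let $L$ be a subgroup of $K$ (possibly $K$ itself) that acts transitively on the vertices of $T$. A decorated tree (or $L$-decorated tree) is any locally finite graph $G=(V(T),E(T)\cup E')$, where $E'$ is a set of unordered pairs of distinct vertices of $T$ with $L\cdot E'=E'$. *)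

theory Defs
  imports "HOL-Probability.Probability" "HOL-Algebra.Bij"
begin

text \<open>
  A simple undirected graph is given by a vertex set \<open>V\<close> and a set \<open>E\<close> of two-element
  subsets of \<open>V\<close>.
\<close>

definition unordered_pairs :: "'a set \<Rightarrow> 'a set set" where
  "unordered_pairs V = {{x, y} | x y. x \<in> V \<and> y \<in> V \<and> x \<noteq> y}"

definition simple_graph :: "'a set \<Rightarrow> 'a set set \<Rightarrow> bool" where
  "simple_graph V E \<longleftrightarrow> E \<subseteq> unordered_pairs V"

definition neighbours :: "'a set \<Rightarrow> 'a set set \<Rightarrow> 'a \<Rightarrow> 'a set" where
  "neighbours V E x = {y \<in> V. {x, y} \<in> E}"

definition locally_finite_graph :: "'a set \<Rightarrow> 'a set set \<Rightarrow> bool" where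
  "locally_finite_graph V E \<longleftrightarrow> simple_graph V E \<and> (\<forall>x\<in>V. finite (neighbours V E x))"

definition regular_graph :: "'a set \<Rightarrow> 'a set set \<Rightarrow> nat \<Rightarrow> bool" where
  "regular_graph V E k \<longleftrightarrow>
     simple_graph V E \<and> (\<forall>x\<in>V. finite (neighbours V E x) \<and> card (neighbours V E x) = k)"

text \<open>Finite simple paths are represented by their vertex lists; one-vertex paths are allowed.\<close>

definition graph_path :: "'a set \<Rightarrow> 'a set set \<Rightarrow> 'a list \<Rightarrow> bool" where
  "graph_path V E xs \<longleftrightarrow>
     xs \<noteq> [] \<and> set xs \<subseteq> V \<and> distinct xs \<and>
     (\<forall>i. Suc i < length xs \<longrightarrow> {xs ! i, xs ! Suc i} \<in> E)"

definition connected_graph :: "'a set \<Rightarrow> 'a set set \<Rightarrow> bool" where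
  "connected_graph V E \<longleftrightarrow>
     V \<noteq> {} \<and> (\<forall>x\<in>V. \<forall>y\<in>V. \<exists>xs. graph_path V E xs \<and> hd xs = x \<and> last xs = y)"

definition graph_cycle :: "'a set \<Rightarrow> 'a set set \<Rightarrow> 'a list \<Rightarrow> bool" where
  "graph_cycle V E xs \<longleftrightarrow> graph_path V E xs \<and> length xs \<ge> 3 \<and> {last xs, hd xs} \<in> E"

definition tree_graph :: "'a set \<Rightarrow> 'a set set \<Rightarrow> bool" where
  "tree_graph V E \<longleftrightarrow> simple_graph V E \<and> connected_graph V E \<and> (\<nexists>xs. graph_cycle V E xs)"


definition rays :: "'a set \<Rightarrow> 'a set set \<Rightarrow> (nat \<Rightarrow> 'a) set" where
  "rays V E = {r. inj r \<and> range r \<subseteq> V \<and> (\<forall>n. {r n, r (Suc n)} \<in> E)}"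

definition ray_edges :: "(nat \<Rightarrow> 'a) \<Rightarrow> 'a set set" where
  "ray_edges r = {{r n, r (Suc n)} | n. True}"

definition ray_equiv :: "'a set \<Rightarrow> 'a set set \<Rightarrow> ((nat \<Rightarrow> 'a) \<times> (nat \<Rightarrow> 'a)) set" where
  "ray_equiv V E = {(r, s). r \<in> rays V E \<and> s \<in> rays V E \<and>
     finite ((ray_edges r - ray_edges s) \<union> (ray_edges s - ray_edges r))}"

definition graph_ends :: "'a set \<Rightarrow> 'a set set \<Rightarrow> (nat \<Rightarrow> 'a) set set" where
  "graph_ends V E = rays V E // ray_equiv V E"

lemma equiv_ray_equiv: "equiv (rays V E) (ray_equiv V E)"
proof (rule equivI)
  show "ray_equiv V E \<subseteq> rays V E \<times> rays V E"
    by (auto simp: ray_equiv_def)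
  show "refl_on (rays V E) (ray_equiv V E)"
    by (auto simp: refl_on_def ray_equiv_def)
  show "sym (ray_equiv V E)"
    by (auto simp: sym_def ray_equiv_def)
  show "trans (ray_equiv V E)"
  proof (rule transI)
    fix r s t
    assume rs: "(r, s) \<in> ray_equiv V E" and st: "(s, t) \<in> ray_equiv V E"
    have "(ray_edges r - ray_edges t) \<union> (ray_edges t - ray_edges r) \<subseteq>
        ((ray_edges r - ray_edges s) \<union> (ray_edges s - ray_edges r)) \<union>
        ((ray_edges s - ray_edges t) \<union> (ray_edges t - ray_edges s))"
      by blast
    with rs st show "(r, t) \<in> ray_equiv V E"
      by (auto simp: ray_equiv_def intro: finite_subset)
  qed
qed

text \<open>
  Automorphisms are elements of the permutation group \<^const>\<open>BijGroup\<close> of \<open>V\<close>, i.e. they are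
  extensional functions, composed by \<^const>\<open>compose\<close>.
\<close>

definition graph_automorphisms :: "'a set \<Rightarrow> 'a set set \<Rightarrow> ('a \<Rightarrow> 'a) set" where
  "graph_automorphisms V E =
     {\<alpha> \<in> Bij V. \<forall>x\<in>V. \<forall>y\<in>V. {\<alpha> x, \<alpha> y} \<in> E \<longleftrightarrow> {x, y} \<in> E}"

definition end_stabilizer :: "'a set \<Rightarrow> 'a set set \<Rightarrow> (nat \<Rightarrow> 'a) set \<Rightarrow> ('a \<Rightarrow> 'a) set" where
  "end_stabilizer V E \<xi> = {\<alpha> \<in> graph_automorphisms V E. (\<lambda>r. \<alpha> \<circ> r) ` \<xi> = \<xi>}"

definition vertex_transitive_on :: "('a \<Rightarrow> 'a) set \<Rightarrow> 'a set \<Rightarrow> bool" where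
  "vertex_transitive_on L V \<longleftrightarrow> (\<forall>x\<in>V. \<forall>y\<in>V. \<exists>\<alpha>\<in>L. \<alpha> x = y)"

text \<open>\<open>E\<close> is the full edge set \<open>E(T) \<union> E'\<close>; the two parts need not be disjoint.\<close>

definition decorated_tree :: "'a set \<Rightarrow> 'a set set \<Rightarrow> ('a \<Rightarrow> 'a) set \<Rightarrow> 'a set set \<Rightarrow> bool" where
  "decorated_tree V T L E \<longleftrightarrow>
     locally_finite_graph V E \<and>
     (\<exists>E'. E' \<subseteq> unordered_pairs V \<and> {\<alpha> ` e | \<alpha> e. \<alpha> \<in> L \<and> e \<in> E'} = E' \<and> E = T \<union> E')"


text \<open>
  A configuration \<open>\<omega>\<close> is the indicator function of the random set of open edges. The measure is
  only meaningful for \<open>0 \<le> p \<le> 1\<close>.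
\<close>

definition percolation :: "'a set set \<Rightarrow> real \<Rightarrow> ('a set \<Rightarrow> bool) measure" where
  "percolation E p = (\<Pi>\<^sub>M e\<in>E. measure_pmf (bernoulli_pmf p))"

definition open_edges :: "'a set set \<Rightarrow> ('a set \<Rightarrow> bool) \<Rightarrow> 'a set set" where
  "open_edges E \<omega> = {e \<in> E. \<omega> e}"

definition cluster :: "'a set \<Rightarrow> 'a set set \<Rightarrow> ('a set \<Rightarrow> bool) \<Rightarrow> 'a \<Rightarrow> 'a set" where
  "cluster V E \<omega> x = {y. \<exists>xs. graph_path V (open_edges E \<omega>) xs \<and> hd xs = x \<and> last xs = y}"

definition has_infinite_cluster :: "'a set \<Rightarrow> 'a set set \<Rightarrow> ('a set \<Rightarrow> bool) \<Rightarrow> bool" where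
  "has_infinite_cluster V E \<omega> \<longleftrightarrow> (\<exists>x\<in>V. infinite (cluster V E \<omega> x))"

text \<open>
  For a connected, locally finite infinite graph, \<open>V\<close> is countable, so the event below is
  measurable, and \<open>1\<close> belongs to the set, so the infimum is that of a nonempty set bounded below.
\<close>

definition critical_probability :: "'a set \<Rightarrow> 'a set set \<Rightarrow> real" where
  "critical_probability V E = Inf {p. 0 \<le> p \<and> p \<le> 1 \<and>
     measure (percolation E p)
       {\<omega> \<in> space (percolation E p). has_infinite_cluster V E \<omega>} = 1}"

end

theory Submission
  imports Defs
begin

text \<open>
  The end \<open>\<xi>\<close> orients the tree: every vertex has one parent, the next vertex on its ray towards
  \<open>\<xi>\<close>, and \<open>d\<close> children. The group \<open>L\<close> commutes with the parent map, so local finiteness and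
  transitivity bound how far an edge of \<open>G\<close> reaches in the tree. All later arguments use only these
  facts, which are collected in the locale \<open>horocyclic_graph\<close>.

  Let \<open>block x n\<close> consist of the descendants of \<open>x\<close> down to depth \<open>n\<close>, and let \<open>mean x n p\<close> be the
  expected number of depth-\<open>n\<close> descendants of \<open>x\<close> joined to \<open>x\<close> by an open path inside \<open>block x n\<close>.
  It depends on finitely many edges, hence is continuous in \<open>p\<close>, and by transitivity it does not
  depend on \<open>x\<close>. The theorem follows from two implications, valid for a given \<open>p\<close>, which make the
  existence of an infinite cluster an open condition in \<open>p\<close>.

  If \<open>mean x n p > 1\<close>, there is an infinite cluster almost surely (\<open>supercritical_of_mean\<close>). The
  blocks hanging below distinct vertices of the same level share no vertices, and share no edges with
  the block above them, so the vertices reached at depths \<open>n, 2 n, 3 n, \<dots>\<close> dominate a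
  supercritical Galton-Watson process. Thus a descent to any depth \<open>k n\<close> has probability at least
  some \<open>\<delta> > 0\<close>, and the \<open>d ^ m\<close> disjoint subtrees at level \<open>m\<close> give independent attempts.

  If \<open>p < 1\<close> and there is an infinite cluster with positive probability, then \<open>mean x n p > 1\<close> for
  some \<open>x\<close> and \<open>n\<close> (\<open>mean_of_infinite_cluster\<close>). Only boundedly many edges leave the set of
  descendants of a vertex, and for ancestors far enough apart these cuts are disjoint. So a cluster
  cannot climb towards \<open>\<xi>\<close> for ever, and some vertex \<open>v\<close> has, with positive probability, an infinite
  cluster inside the descendants of one of its ancestors \<open>x\<close> (\<open>infinite_below\<close>). Consider the front,
  the vertices near depth \<open>n\<close> that \<open>v\<close> reaches inside \<open>block x n\<close>. Whenever the front is nonempty but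
  small, the cluster stops there with probability bounded below; among depths at least \<open>R\<close> apart,
  where \<open>R\<close> bounds the reach of edges, it can stop at only one.
  So the front is rarely small, and its expected size is unbounded (\<open>expected_front_large\<close>). Opening
  a bounded number of tree edges turns front vertices into depth-\<open>n\<close> descendants joined to \<open>x\<close>.

  The first implication, applied just below \<open>p = 1\<close>, shows that the critical probability is less
  than 1. If critical percolation had an infinite cluster with positive probability, some
  \<open>mean x n p\<close> would exceed 1 at the critical \<open>p\<close>, hence also at a smaller parameter, which would
  then have an infinite cluster almost surely.
\<close>

section \<open>Events depending on finitely many edges\<close>

lemma prob_space_percolation: "prob_space (percolation E p)"
  unfolding percolation_def by (intro prob_space_PiM prob_space_measure_pmf)

lemma space_percolation: "space (percolation E p) = PiE E (\<lambda>_. UNIV)"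
  by (simp add: percolation_def space_PiM)

text \<open>
  \<open>depends_on F Q\<close>: whether \<open>Q\<close> holds is determined by the states of the edges in \<open>F\<close>. The predicate
  concerns arbitrary functions \<open>\<omega>\<close>, not only the extensional ones of the product space.
\<close>

definition depends_on :: "'a set set \<Rightarrow> (('a set \<Rightarrow> bool) \<Rightarrow> bool) \<Rightarrow> bool" where
  "depends_on F Q \<longleftrightarrow> (\<forall>\<omega> \<omega>'. (\<forall>e\<in>F. \<omega> e = \<omega>' e) \<longrightarrow> Q \<omega> = Q \<omega>')"

lemma depends_onI:
  assumes "\<And>\<omega> \<omega>'. (\<And>e. e \<in> F \<Longrightarrow> \<omega> e = \<omega>' e) \<Longrightarrow> Q \<omega> \<Longrightarrow> Q \<omega>'"
  shows "depends_on F Q"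
  unfolding depends_on_def
proof (intro allI impI)
  fix \<omega> \<omega>' :: "'a set \<Rightarrow> bool"
  assume *: "\<forall>e\<in>F. \<omega> e = \<omega>' e"
  show "Q \<omega> = Q \<omega>'" using assms[of \<omega> \<omega>'] assms[of \<omega>' \<omega>] * by auto
qed

lemma depends_onD: "depends_on F Q \<Longrightarrow> (\<And>e. e \<in> F \<Longrightarrow> \<omega> e = \<omega>' e) \<Longrightarrow> Q \<omega> = Q \<omega>'"
  unfolding depends_on_def by blast

lemma depends_on_mono: "depends_on F Q \<Longrightarrow> F \<subseteq> G \<Longrightarrow> depends_on G Q"
  unfolding depends_on_def by blast

lemma depends_on_conj: "depends_on F Q \<Longrightarrow> depends_on G R \<Longrightarrow> depends_on (F \<union> G) (\<lambda>\<omega>. Q \<omega> \<and> R \<omega>)"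
  unfolding depends_on_def by (metis UnI1 UnI2)

lemma depends_on_not: "depends_on F Q \<Longrightarrow> depends_on F (\<lambda>\<omega>. \<not> Q \<omega>)"
  unfolding depends_on_def by metis

lemma depends_on_ball: "(\<And>i. i \<in> I \<Longrightarrow> depends_on (F i) (Q i)) \<Longrightarrow> depends_on (\<Union>i\<in>I. F i) (\<lambda>\<omega>. \<forall>i\<in>I. Q i \<omega>)"
  unfolding depends_on_def by (metis UN_I)

lemma depends_on_bex: "(\<And>i. i \<in> I \<Longrightarrow> depends_on F (Q i)) \<Longrightarrow> depends_on F (\<lambda>\<omega>. \<exists>i\<in>I. Q i \<omega>)"
  unfolding depends_on_def by metis

lemma depends_on_Collect_eq:
  "(\<And>i. i \<in> I \<Longrightarrow> depends_on F (Q i)) \<Longrightarrow> depends_on F (\<lambda>\<omega>. {i\<in>I. Q i \<omega>} = U)"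
proof (rule depends_onI)
  fix \<omega> \<omega>'
  assume *: "\<And>i. i \<in> I \<Longrightarrow> depends_on F (Q i)" and eq: "\<And>e. e \<in> F \<Longrightarrow> \<omega> e = \<omega>' e" and U: "{i \<in> I. Q i \<omega>} = U"
  have "\<And>i. i \<in> I \<Longrightarrow> Q i \<omega> = Q i \<omega>'" using *[THEN depends_onD] eq by blast
  with U show "{i \<in> I. Q i \<omega>'} = U" by blast
qed

text \<open>The probability that \<open>\<eta>\<close> is the set of open edges among those of \<open>F\<close>, for \<open>\<eta> \<subseteq> F\<close>.\<close>

definition weight :: "real \<Rightarrow> 'a set set \<Rightarrow> 'a set set \<Rightarrow> real" where
  "weight p F \<eta> = (\<Prod>e\<in>F. if e \<in> \<eta> then p else 1 - p)"

lemma cylinder: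
  assumes "finite F" "F \<subseteq> E"
  shows "{\<omega> \<in> space (percolation E p). \<forall>e\<in>F. \<omega> e = (e \<in> \<eta>)} \<in> sets (percolation E p)"
    and "0 \<le> p \<Longrightarrow> p \<le> 1 \<Longrightarrow> \<P>(\<omega> in percolation E p. \<forall>e\<in>F. \<omega> e = (e \<in> \<eta>)) = weight p F \<eta>"
proof -
  interpret P: product_prob_space "\<lambda>e::'a set. measure_pmf (bernoulli_pmf p)" E
    by unfold_locales
  let ?X = "\<lambda>e. {e \<in> \<eta>}"
  have eq: "{\<omega> \<in> space (percolation E p). \<forall>e\<in>F. \<omega> e = (e \<in> \<eta>)} =
      prod_emb E (\<lambda>_. measure_pmf (bernoulli_pmf p)) F (Pi\<^sub>E F ?X)"
    using assms by (auto simp: prod_emb_def space_percolation PiE_def restrict_def extensional_def Pi_def)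
  show "{\<omega> \<in> space (percolation E p). \<forall>e\<in>F. \<omega> e = (e \<in> \<eta>)} \<in> sets (percolation E p)"
    unfolding eq unfolding percolation_def using assms by (intro sets_PiM_I) auto
  assume p: "0 \<le> p" "p \<le> 1"
  have "measure (measure_pmf (bernoulli_pmf p)) {b} = (if b then p else 1 - p)" for b
    using p by (cases b) (auto simp: measure_pmf_single)
  then show "\<P>(\<omega> in percolation E p. \<forall>e\<in>F. \<omega> e = (e \<in> \<eta>)) = weight p F \<eta>"
    unfolding eq unfolding weight_def percolation_def
    using assms by (subst P.measure_PiM_emb) (auto intro!: prod.cong)
qed

lemma depends_on_decomp:
  assumes "depends_on F Q"
  shows "{\<omega> \<in> S. Q \<omega>} = (\<Union>\<eta>\<in>{\<eta>\<in>Pow F. Q (\<lambda>e. e \<in> \<eta>)}. {\<omega> \<in> S. \<forall>e\<in>F. \<omega> e = (e \<in> \<eta>)})"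
proof (intro equalityI subsetI)
  fix \<omega> assume "\<omega> \<in> {\<omega> \<in> S. Q \<omega>}"
  moreover then have "Q (\<lambda>e. e \<in> {e\<in>F. \<omega> e})"
    using depends_onD[OF assms, of \<omega> "\<lambda>e. e \<in> {e\<in>F. \<omega> e}"] by auto
  ultimately show "\<omega> \<in> (\<Union>\<eta>\<in>{\<eta>\<in>Pow F. Q (\<lambda>e. e \<in> \<eta>)}. {\<omega> \<in> S. \<forall>e\<in>F. \<omega> e = (e \<in> \<eta>)})"
    by (intro UN_I[of "{e\<in>F. \<omega> e}"]) auto
next
  fix \<omega> assume "\<omega> \<in> (\<Union>\<eta>\<in>{\<eta>\<in>Pow F. Q (\<lambda>e. e \<in> \<eta>)}. {\<omega> \<in> S. \<forall>e\<in>F. \<omega> e = (e \<in> \<eta>)})"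
  then obtain \<eta> where "Q (\<lambda>e. e \<in> \<eta>)" "\<omega> \<in> S" "\<forall>e\<in>F. \<omega> e = (e \<in> \<eta>)" by auto
  then show "\<omega> \<in> {\<omega> \<in> S. Q \<omega>}"
    using depends_onD[OF assms, of \<omega> "\<lambda>e. e \<in> \<eta>"] by auto
qed

lemma measurable_depends_on:
  assumes "finite F" "F \<subseteq> E" "depends_on F Q"
  shows "{\<omega> \<in> space (percolation E p). Q \<omega>} \<in> sets (percolation E p)"
  unfolding depends_on_decomp[OF assms(3)]
  using assms by (intro sets.finite_UN) (auto intro!: cylinder)

lemma prob_depends_on:
  assumes "finite F" "F \<subseteq> E" "depends_on F Q" "0 \<le> p" "p \<le> 1"
  shows "\<P>(\<omega> in percolation E p. Q \<omega>) = (\<Sum>\<eta>\<in>{\<eta>\<in>Pow F. Q (\<lambda>e. e \<in> \<eta>)}. weight p F \<eta>)"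
proof -
  interpret prob_space "percolation E p" by (rule prob_space_percolation)
  have "\<P>(\<omega> in percolation E p. Q \<omega>) =
      (\<Sum>\<eta>\<in>{\<eta>\<in>Pow F. Q (\<lambda>e. e \<in> \<eta>)}. \<P>(\<omega> in percolation E p. \<forall>e\<in>F. \<omega> e = (e \<in> \<eta>)))"
    unfolding depends_on_decomp[OF assms(3)]
    using assms by (intro finite_measure_finite_Union) (auto intro!: cylinder simp: disjoint_family_on_def)
  then show ?thesis using assms by (simp add: cylinder)
qed

lemma continuous_prob:
  assumes "finite F" "F \<subseteq> E" "depends_on F Q"
  shows "continuous_on {0..1} (\<lambda>p. \<P>(\<omega> in percolation E p. Q \<omega>))"
proof -
  have "continuous_on {0..1} (\<lambda>p::real. if b then p else 1 - p)" for b
    by (cases b) (auto intro!: continuous_intros)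
  then have "continuous_on {0..1} (\<lambda>p. \<Sum>\<eta>\<in>{\<eta>\<in>Pow F. Q (\<lambda>e. e \<in> \<eta>)}. weight p F \<eta>)"
    unfolding weight_def by (intro continuous_on_sum continuous_on_prod) auto
  then show ?thesis
    by (rule continuous_on_eq) (use prob_depends_on[OF assms] in simp)
qed

lemma prob_indep:
  assumes F: "finite F" "F \<subseteq> E" "depends_on F Q"
    and G: "finite G" "G \<subseteq> E" "depends_on G R"
    and dj: "F \<inter> G = {}" and p: "0 \<le> p" "p \<le> 1"
  shows "\<P>(\<omega> in percolation E p. Q \<omega> \<and> R \<omega>) = \<P>(\<omega> in percolation E p. Q \<omega>) * \<P>(\<omega> in percolation E p. R \<omega>)"
proof -
  have dQ: "Q (\<lambda>e. e \<in> \<eta> \<union> \<zeta>) = Q (\<lambda>e. e \<in> \<eta>)" if "\<zeta> \<subseteq> G" for \<eta> \<zeta>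
    using that dj by (intro depends_onD[OF F(3)]) auto
  have dR: "R (\<lambda>e. e \<in> \<eta> \<union> \<zeta>) = R (\<lambda>e. e \<in> \<zeta>)" if "\<eta> \<subseteq> F" for \<eta> \<zeta>
    using that dj by (intro depends_onD[OF G(3)]) auto
  have w: "weight p (F \<union> G) (\<eta> \<union> \<zeta>) = weight p F \<eta> * weight p G \<zeta>" if "\<eta> \<subseteq> F" "\<zeta> \<subseteq> G" for \<eta> \<zeta>
    unfolding weight_def using F G dj that
    by (subst prod.union_disjoint) (auto intro!: arg_cong2[where f="(*)"] prod.cong)
  let ?A = "{\<eta>\<in>Pow F. Q (\<lambda>e. e \<in> \<eta>)}" and ?B = "{\<zeta>\<in>Pow G. R (\<lambda>e. e \<in> \<zeta>)}"
  have "\<P>(\<omega> in percolation E p. Q \<omega> \<and> R \<omega>) =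
      (\<Sum>\<eta>\<in>{\<eta>\<in>Pow (F \<union> G). Q (\<lambda>e. e \<in> \<eta>) \<and> R (\<lambda>e. e \<in> \<eta>)}. weight p (F \<union> G) \<eta>)"
    using assms by (intro prob_depends_on depends_on_conj) auto
  also have "\<dots> = (\<Sum>(\<eta>,\<zeta>)\<in>?A \<times> ?B. weight p F \<eta> * weight p G \<zeta>)"
  proof (rule sum.reindex_bij_witness[where i = "\<lambda>(\<eta>,\<zeta>). \<eta> \<union> \<zeta>" and j = "\<lambda>\<eta>. (\<eta> \<inter> F, \<eta> \<inter> G)"])
    fix \<eta> assume "\<eta> \<in> {\<eta>\<in>Pow (F \<union> G). Q (\<lambda>e. e \<in> \<eta>) \<and> R (\<lambda>e. e \<in> \<eta>)}"
    then have *: "\<eta> = (\<eta> \<inter> F) \<union> (\<eta> \<inter> G)" "Q (\<lambda>e. e \<in> \<eta>)" "R (\<lambda>e. e \<in> \<eta>)" by auto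
    show "(case (\<eta> \<inter> F, \<eta> \<inter> G) of (\<eta>, \<zeta>) \<Rightarrow> \<eta> \<union> \<zeta>) = \<eta>" using * by auto
    show "(\<eta> \<inter> F, \<eta> \<inter> G) \<in> ?A \<times> ?B"
      using * dQ[of "\<eta> \<inter> G" "\<eta> \<inter> F"] dR[of "\<eta> \<inter> F" "\<eta> \<inter> G"] by auto
    show "(case (\<eta> \<inter> F, \<eta> \<inter> G) of (\<eta>, \<zeta>) \<Rightarrow> weight p F \<eta> * weight p G \<zeta>) = weight p (F \<union> G) \<eta>"
      using w[of "\<eta> \<inter> F" "\<eta> \<inter> G"] *(1) by auto
  next
    fix b assume "b \<in> ?A \<times> ?B"
    then obtain \<eta> \<zeta> where b: "b = (\<eta>, \<zeta>)" "\<eta> \<subseteq> F" "\<zeta> \<subseteq> G" "Q (\<lambda>e. e \<in> \<eta>)" "R (\<lambda>e. e \<in> \<zeta>)" by auto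
    have "(\<eta> \<union> \<zeta>) \<inter> F = \<eta>" "(\<eta> \<union> \<zeta>) \<inter> G = \<zeta>" using b dj by auto
    then show "((case b of (\<eta>, \<zeta>) \<Rightarrow> \<eta> \<union> \<zeta>) \<inter> F, (case b of (\<eta>, \<zeta>) \<Rightarrow> \<eta> \<union> \<zeta>) \<inter> G) = b"
      using b by simp
    show "(case b of (\<eta>, \<zeta>) \<Rightarrow> \<eta> \<union> \<zeta>) \<in> {\<eta>\<in>Pow (F \<union> G). Q (\<lambda>e. e \<in> \<eta>) \<and> R (\<lambda>e. e \<in> \<eta>)}"
      using b dQ[of \<zeta> \<eta>] dR[of \<eta> \<zeta>] by auto
  qed
  also have "\<dots> = (\<Sum>\<eta>\<in>?A. weight p F \<eta>) * (\<Sum>\<zeta>\<in>?B. weight p G \<zeta>)"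
    by (simp add: sum_product sum.cartesian_product)
  finally show ?thesis using prob_depends_on[OF F p] prob_depends_on[OF G p] by simp
qed

lemma prob_indep_family:
  assumes "finite I" "\<And>i. i \<in> I \<Longrightarrow> finite (F i)" "\<And>i. i \<in> I \<Longrightarrow> F i \<subseteq> E" "\<And>i. i \<in> I \<Longrightarrow> depends_on (F i) (Q i)"
    and "disjoint_family_on F I" and p: "0 \<le> p" "p \<le> 1"
  shows "\<P>(\<omega> in percolation E p. \<forall>i\<in>I. Q i \<omega>) = (\<Prod>i\<in>I. \<P>(\<omega> in percolation E p. Q i \<omega>))"
  using assms(1-5)
proof (induction I rule: finite_induct)
  case empty
  interpret prob_space "percolation E p" by (rule prob_space_percolation)
  show ?case by (simp add: prob_space)
next
  case (insert i I)
  have "\<P>(\<omega> in percolation E p. \<forall>i\<in>insert i I. Q i \<omega>) = \<P>(\<omega> in percolation E p. Q i \<omega> \<and> (\<forall>i\<in>I. Q i \<omega>))"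
    by simp
  also have "\<dots> = \<P>(\<omega> in percolation E p. Q i \<omega>) * \<P>(\<omega> in percolation E p. \<forall>i\<in>I. Q i \<omega>)"
    using insert p
    by (intro prob_indep[of "F i" _ _ "\<Union>i\<in>I. F i"] depends_on_ball)
       (auto simp: disjoint_family_on_def)
  also have "\<P>(\<omega> in percolation E p. \<forall>i\<in>I. Q i \<omega>) = (\<Prod>i\<in>I. \<P>(\<omega> in percolation E p. Q i \<omega>))"
    using insert by (intro insert.IH) (auto simp: disjoint_family_on_def)
  finally show ?case using insert by simp
qed

lemma
  assumes "finite F" "F \<subseteq> E" "0 \<le> p" "p \<le> 1"
  shows prob_all_open: "\<P>(\<omega> in percolation E p. \<forall>e\<in>F. \<omega> e) = p ^ card F"
    and prob_all_closed: "\<P>(\<omega> in percolation E p. \<forall>e\<in>F. \<not> \<omega> e) = (1 - p) ^ card F"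
  using cylinder(2)[OF assms, of F] cylinder(2)[OF assms, of "{}"] by (simp_all add: weight_def)

text \<open>
  Insertion tolerance for increasing events: opening the edges of \<open>G\<close> by force costs at most the
  factor \<open>p ^ card G\<close>.
\<close>

lemma prob_insert_open:
  assumes F: "finite F" "F \<subseteq> E" "depends_on F Q" and G: "G \<subseteq> F"
    and mono: "\<And>\<omega> \<omega>'. (\<And>e. \<omega> e \<Longrightarrow> \<omega>' e) \<Longrightarrow> Q \<omega> \<Longrightarrow> Q \<omega>'" and p: "0 \<le> p" "p \<le> 1"
  shows "p ^ card G * \<P>(\<omega> in percolation E p. Q \<omega>) \<le> \<P>(\<omega> in percolation E p. Q \<omega> \<and> (\<forall>e\<in>G. \<omega> e))"
proof -
  interpret prob_space "percolation E p" by (rule prob_space_percolation)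
  have fG: "finite G" "G \<subseteq> E" using F G finite_subset by auto
  \<comment> \<open>\<open>Q'\<close> contains \<open>Q\<close> by monotonicity, ignores \<open>G\<close>, and agrees with \<open>Q\<close> once \<open>G\<close> is open.\<close>
  define Q' where "Q' \<omega> = Q (\<lambda>e. e \<in> G \<or> \<omega> e)" for \<omega>
  have dep: "depends_on (F - G) Q'"
    unfolding Q'_def by (rule depends_onI) (use depends_onD[OF F(3)] in \<open>smt (verit) DiffI\<close>)
  have Q_Q': "Q \<omega> \<Longrightarrow> Q' \<omega>" for \<omega> unfolding Q'_def by (rule mono) auto
  have dG: "depends_on G (\<lambda>\<omega>. \<forall>e\<in>G. \<omega> e)" by (rule depends_onI) auto
  have "\<P>(\<omega> in percolation E p. Q \<omega>) \<le> \<P>(\<omega> in percolation E p. Q' \<omega>)"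
    using F dep by (intro finite_measure_mono measurable_depends_on[of "F - G"])
      (auto simp: Q'_def[symmetric] Q_Q')
  then have "p ^ card G * \<P>(\<omega> in percolation E p. Q \<omega>) \<le> p ^ card G * \<P>(\<omega> in percolation E p. Q' \<omega>)"
    using p by (intro mult_left_mono) auto
  also have "\<dots> = \<P>(\<omega> in percolation E p. Q' \<omega> \<and> (\<forall>e\<in>G. \<omega> e))"
    using F fG dep dG p by (subst prob_indep[of "F - G" _ _ G]) (auto simp: prob_all_open)
  also have "{\<omega> \<in> space (percolation E p). Q' \<omega> \<and> (\<forall>e\<in>G. \<omega> e)} = {\<omega> \<in> space (percolation E p). Q \<omega> \<and> (\<forall>e\<in>G. \<omega> e)}"
  proof -
    have "(\<lambda>e. e \<in> G \<or> \<omega> e) = \<omega>" if "\<forall>e\<in>G. \<omega> e" for \<omega> :: "'a set \<Rightarrow> bool" using that by auto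
    then show ?thesis unfolding Q'_def by auto
  qed
  finally show ?thesis .
qed

lemma prob_reindex:
  assumes "finite F" "F \<subseteq> E" "depends_on F Q" and f: "bij_betw f E E"
    and p: "0 \<le> p" "p \<le> 1"
  shows "\<P>(\<omega> in percolation E p. Q (\<lambda>e. \<omega> (f e))) = \<P>(\<omega> in percolation E p. Q \<omega>)"
proof -
  let ?M = "\<lambda>e. measure_pmf (bernoulli_pmf p)"
  let ?g = "\<lambda>\<omega>. \<lambda>e\<in>E. \<omega> (f e)"
  have d: "distr (percolation E p) (percolation E p) ?g = percolation E p"
    using distr_PiM_reindex[of E ?M f E] f
    by (auto simp: percolation_def bij_betw_def prob_space_measure_pmf)
  have m: "?g \<in> percolation E p \<rightarrow>\<^sub>M percolation E p"
    unfolding percolation_def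
    by (rule measurable_restrict, rule measurable_component_singleton) (use f in \<open>auto simp: bij_betw_def\<close>)
  have "Q (?g \<omega>) = Q (\<lambda>e. \<omega> (f e))" for \<omega>
    using assms(2) by (intro depends_onD[OF assms(3)]) auto
  moreover have "\<P>(\<omega> in percolation E p. Q \<omega>) = measure (distr (percolation E p) (percolation E p) ?g) {\<omega> \<in> space (percolation E p). Q \<omega>}"
    by (simp add: d)
  moreover have "\<dots> = \<P>(\<omega> in percolation E p. Q (?g \<omega>))"
    using measurable_space[OF m]
    by (subst measure_distr[OF m]) (auto intro!: measurable_depends_on[OF assms(1-3)] arg_cong[where f="measure _"])
  ultimately show ?thesis by simp
qed

lemma prob_partition:
  assumes S: "finite S" and F: "finite F" "F \<subseteq> E" "\<And>y. y \<in> S \<Longrightarrow> depends_on F (Q y)"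
    and R: "{\<omega> \<in> space (percolation E p). R \<omega>} \<in> sets (percolation E p)"
  shows "\<P>(\<omega> in percolation E p. R \<omega>) = (\<Sum>U\<in>Pow S. \<P>(\<omega> in percolation E p. {y\<in>S. Q y \<omega>} = U \<and> R \<omega>))"
proof -
  interpret prob_space "percolation E p" by (rule prob_space_percolation)
  have *: "{\<omega> \<in> space (percolation E p). R \<omega>} = (\<Union>U\<in>Pow S. {\<omega> \<in> space (percolation E p). {y\<in>S. Q y \<omega>} = U \<and> R \<omega>})"
    (is "?A = (\<Union>U\<in>Pow S. ?B U)")
  proof (intro equalityI subsetI)
    fix \<omega> assume "\<omega> \<in> ?A"
    then show "\<omega> \<in> (\<Union>U\<in>Pow S. ?B U)" by (intro UN_I[of "{y\<in>S. Q y \<omega>}"]) simp_all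
  next
    fix \<omega> assume "\<omega> \<in> (\<Union>U\<in>Pow S. ?B U)"
    then show "\<omega> \<in> ?A" by simp
  qed
  have "{\<omega> \<in> space (percolation E p). {y\<in>S. Q y \<omega>} = U \<and> R \<omega>} \<in> sets (percolation E p)" for U
    using F by (intro sets.sets_Collect_conj R measurable_depends_on[of F] depends_on_Collect_eq) auto
  then show ?thesis
    by (subst *, intro finite_measure_finite_Union) (use S in \<open>auto simp: disjoint_family_on_def\<close>)
qed

lemma sum_prob_eq_sum_card:
  assumes S: "finite S" and F: "finite F" "F \<subseteq> E" "\<And>y. y \<in> S \<Longrightarrow> depends_on F (Q y)"
  shows "(\<Sum>y\<in>S. \<P>(\<omega> in percolation E p. Q y \<omega>)) =
     (\<Sum>U\<in>Pow S. \<P>(\<omega> in percolation E p. {y\<in>S. Q y \<omega>} = U) * card U)"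
proof -
  let ?P = "\<lambda>R. \<P>(\<omega> in percolation E p. R \<omega>)"
  have "(\<Sum>y\<in>S. ?P (Q y)) = (\<Sum>y\<in>S. \<Sum>U\<in>Pow S. ?P (\<lambda>\<omega>. {y\<in>S. Q y \<omega>} = U \<and> Q y \<omega>))"
    by (intro sum.cong refl prob_partition[OF assms] measurable_depends_on[OF F(1,2)] F(3)) auto
  also have "\<dots> = (\<Sum>y\<in>S. \<Sum>U\<in>Pow S. ?P (\<lambda>\<omega>. {y\<in>S. Q y \<omega>} = U) * of_bool (y \<in> U))"
  proof (intro sum.cong refl)
    fix y U assume "y \<in> S" "U \<in> Pow S"
    then have "{\<omega> \<in> space (percolation E p). {y\<in>S. Q y \<omega>} = U \<and> Q y \<omega>} =
      (if y \<in> U then {\<omega> \<in> space (percolation E p). {y\<in>S. Q y \<omega>} = U} else {})" by auto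
    then show "?P (\<lambda>\<omega>. {y\<in>S. Q y \<omega>} = U \<and> Q y \<omega>) = ?P (\<lambda>\<omega>. {y\<in>S. Q y \<omega>} = U) * of_bool (y \<in> U)"
      by simp
  qed
  also have "\<dots> = (\<Sum>U\<in>Pow S. \<Sum>y\<in>S. ?P (\<lambda>\<omega>. {y\<in>S. Q y \<omega>} = U) * of_bool (y \<in> U))"
    by (rule sum.swap)
  also have "\<dots> = (\<Sum>U\<in>Pow S. ?P (\<lambda>\<omega>. {y\<in>S. Q y \<omega>} = U) * card U)"
  proof (intro sum.cong refl)
    fix U assume "U \<in> Pow S"
    then have "S \<inter> U = U" by auto
    then have "(\<Sum>y\<in>S. of_bool (y \<in> U) :: real) = card U"
      using S by (simp add: of_bool_def sum.If_cases)
    then show "(\<Sum>y\<in>S. ?P (\<lambda>\<omega>. {y\<in>S. Q y \<omega>} = U) * of_bool (y \<in> U)) = ?P (\<lambda>\<omega>. {y\<in>S. Q y \<omega>} = U) * card U"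
      by (simp flip: sum_distrib_left)
  qed
  finally show ?thesis .
qed

section \<open>Open connections\<close>

text \<open>
  \<open>reach F \<omega> x y\<close>: \<open>x\<close> and \<open>y\<close> are joined by a walk along edges of \<open>F\<close> that are open in \<open>\<omega>\<close>. By
  \<open>cluster_eq\<close> below, this describes clusters although those are defined by simple paths.
\<close>

definition reach :: "'a set set \<Rightarrow> ('a set \<Rightarrow> bool) \<Rightarrow> 'a \<Rightarrow> 'a \<Rightarrow> bool" where
  "reach F \<omega> = (\<lambda>u v. {u, v} \<in> F \<and> \<omega> {u, v})\<^sup>*\<^sup>*"

lemma reach_refl [simp, intro]: "reach F \<omega> x x"
  by (simp add: reach_def)

lemma reach_trans: "reach F \<omega> x y \<Longrightarrow> reach F \<omega> y z \<Longrightarrow> reach F \<omega> x z"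
  unfolding reach_def by (rule rtranclp_trans)

lemma reach_edge: "{x, y} \<in> F \<Longrightarrow> \<omega> {x, y} \<Longrightarrow> reach F \<omega> x y"
  unfolding reach_def by auto

lemma reach_induct [consumes 1, case_names base step]:
  assumes "reach F \<omega> x y" "P x"
    "\<And>y z. reach F \<omega> x y \<Longrightarrow> {y, z} \<in> F \<Longrightarrow> \<omega> {y, z} \<Longrightarrow> P y \<Longrightarrow> P z"
  shows "P y"
  using assms(1) unfolding reach_def
  by (induction rule: rtranclp_induct) (use assms(2,3) in \<open>auto simp: reach_def\<close>)

lemma reach_mono:
  assumes "reach F \<omega> x y" "F \<subseteq> F'" "\<And>e. e \<in> F \<Longrightarrow> \<omega> e \<Longrightarrow> \<omega>' e"
  shows "reach F' \<omega>' x y"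
  using assms(1)
proof (induction rule: reach_induct)
  case base
  then show ?case by simp
next
  case (step y z)
  then show ?case using assms by (blast intro: reach_trans reach_edge)
qed

lemma reach_sym: "reach F \<omega> x y \<Longrightarrow> reach F \<omega> y x"
proof (induction rule: reach_induct)
  case base
  then show ?case by simp
next
  case (step y z)
  then have "reach F \<omega> z y" by (intro reach_edge) (auto simp: insert_commute)
  then show ?case using step by (blast intro: reach_trans)
qed

lemma depends_on_reach: "depends_on F (\<lambda>\<omega>. reach F \<omega> x y)"
  by (rule depends_onI) (auto elim: reach_mono)

lemma reach_image:
  assumes "reach F (\<lambda>e. \<omega> (f ` e)) x y" "\<And>e. e \<in> F \<Longrightarrow> f ` e \<in> F'"
  shows "reach F' \<omega> (f x) (f y)"
  using assms(1)
proof (induction rule: reach_induct)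
  case base
  then show ?case by simp
next
  case (step y z)
  then have "reach F' \<omega> (f y) (f z)" using assms(2)[of "{y, z}"] by (intro reach_edge) auto
  then show ?case using step by (blast intro: reach_trans)
qed

text \<open>
  This writes a connection in an infinite graph as a union of events that depend on finitely many
  edges, a countable union if \<open>E\<close> is countable.
\<close>

lemma reach_finite_iff: "reach E \<omega> x y \<longleftrightarrow> (\<exists>F\<in>{F. finite F \<and> F \<subseteq> E}. reach F \<omega> x y)"
proof
  assume "reach E \<omega> x y"
  then show "\<exists>F\<in>{F. finite F \<and> F \<subseteq> E}. reach F \<omega> x y"
  proof (induction rule: reach_induct)
    case base
    then show ?case by (intro bexI[of _ "{}"]) auto
  next
    case (step y z)
    then obtain F where F: "finite F" "F \<subseteq> E" "reach F \<omega> x y" by blast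
    have "reach (insert {y, z} F) \<omega> x y" using F by (auto elim: reach_mono)
    moreover have "reach (insert {y, z} F) \<omega> y z" using step by (auto intro: reach_edge)
    ultimately show ?case using F step by (intro bexI[of _ "insert {y, z} F"]) (auto intro: reach_trans)
  qed
qed (auto elim: reach_mono)

lemma reach_in:
  assumes "reach F \<omega> x y" "x \<in> S" "\<And>e. e \<in> F \<Longrightarrow> e \<subseteq> S"
  shows "y \<in> S"
  using assms(1) by (induction rule: reach_induct) (use assms(2,3) in auto)

lemma measurable_reach:
  assumes "countable E" "F \<subseteq> E"
  shows "{\<omega> \<in> space (percolation E p). reach F \<omega> x y} \<in> sets (percolation E p)"
proof -
  have "countable {G. finite G \<and> G \<subseteq> F}"
    using assms by (intro countable_Collect_finite_subset) (auto intro: countable_subset)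
  then show ?thesis
    unfolding reach_finite_iff[of F]
    using assms by (intro sets.sets_Collect_countable_Ex')
      (auto intro!: measurable_depends_on depends_on_reach)
qed

lemma measurable_infinite_reach:
  assumes "countable E" "F \<subseteq> E" "countable V" "\<And>e. e \<in> F \<Longrightarrow> e \<subseteq> V" "x \<in> V"
  shows "{\<omega> \<in> space (percolation E p). infinite {y. reach F \<omega> x y}} \<in> sets (percolation E p)"
proof -
  let ?B = "{B. finite B \<and> B \<subseteq> V}"
  have c: "countable ?B" by (intro countable_Collect_finite_subset assms)
  have "infinite {y. reach F \<omega> x y} \<longleftrightarrow> (\<forall>B\<in>?B. \<exists>y\<in>V. y \<notin> B \<and> reach F \<omega> x y)" for \<omega>
  proof
    assume inf: "infinite {y. reach F \<omega> x y}"
    show "\<forall>B\<in>?B. \<exists>y\<in>V. y \<notin> B \<and> reach F \<omega> x y"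
    proof
      fix B assume "B \<in> ?B"
      then have "infinite ({y. reach F \<omega> x y} - B)" using inf by auto
      then obtain y where "reach F \<omega> x y" "y \<notin> B" by (metis DiffD1 DiffD2 finite.emptyI ex_in_conv mem_Collect_eq)
      moreover from \<open>reach F \<omega> x y\<close> have "y \<in> V" by (rule reach_in) (use assms in auto)
      ultimately show "\<exists>y\<in>V. y \<notin> B \<and> reach F \<omega> x y" by blast
    qed
  next
    assume *: "\<forall>B\<in>?B. \<exists>y\<in>V. y \<notin> B \<and> reach F \<omega> x y"
    have "{y. reach F \<omega> x y} \<subseteq> V" using reach_in[of F \<omega> x _ V] assms by blast
    then show "infinite {y. reach F \<omega> x y}" using * by blast
  qed
  moreover have "{\<omega> \<in> space (percolation E p). \<forall>B\<in>?B. \<exists>y\<in>V. y \<notin> B \<and> reach F \<omega> x y} \<in> sets (percolation E p)"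
    using assms c
    by (intro sets.sets_Collect_countable_All' sets.sets_Collect_countable_Ex' sets.sets_Collect_conj
        measurable_reach sets.sets_Collect_const) auto
  ultimately show ?thesis by simp
qed

lemma graph_path_iff:
  "graph_path V E xs \<longleftrightarrow> xs \<noteq> [] \<and> set xs \<subseteq> V \<and> distinct xs \<and> successively (\<lambda>u v. {u, v} \<in> E) xs"
  by (simp add: graph_path_def successively_conv_nth)

lemma reach_imp_graph_path:
  assumes "reach F \<omega> x y" "x \<in> V" "\<And>e. e \<in> F \<Longrightarrow> e \<subseteq> V"
  shows "\<exists>xs. graph_path V {e\<in>F. \<omega> e} xs \<and> hd xs = x \<and> last xs = y"
  using assms(1)
proof (induction rule: reach_induct)
  case base
  then show ?case using assms(2) by (intro exI[of _ "[x]"]) (auto simp: graph_path_iff)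
next
  case (step y z)
  then obtain xs where xs: "graph_path V {e\<in>F. \<omega> e} xs" "hd xs = x" "last xs = y" by blast
  show ?case
  proof (cases "z \<in> set xs")
    case True
    then obtain ys zs where eq: "xs = (ys @ [z]) @ zs" by (auto dest: split_list)
    have "graph_path V {e\<in>F. \<omega> e} (ys @ [z])"
      using xs(1) unfolding eq graph_path_iff successively_append_iff[of _ "ys @ [z]"] by auto
    then show ?thesis using xs eq by (intro exI[of _ "ys @ [z]"]) (cases ys; auto)
  next
    case False
    moreover have "z \<in> V" using step assms by auto
    ultimately show ?thesis using xs step
      by (intro exI[of _ "xs @ [z]"]) (auto simp: graph_path_iff successively_append_iff)
  qed
qed

lemma graph_path_imp_reach:
  assumes "graph_path V {e\<in>F. \<omega> e} xs"
  shows "reach F \<omega> (hd xs) (last xs)"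
proof -
  have "xs \<noteq> []" "successively (\<lambda>u v. {u, v} \<in> {e\<in>F. \<omega> e}) xs" using assms by (auto simp: graph_path_iff)
  then show ?thesis
  proof (induction xs rule: induct_list012)
    case (3 x y zs)
    then have "reach F \<omega> x y" "reach F \<omega> y (last (y # zs))" by (auto intro: reach_edge)
    then show ?case by (auto intro: reach_trans)
  qed auto
qed

lemma cluster_eq:
  assumes "E \<subseteq> unordered_pairs V" "x \<in> V"
  shows "cluster V E \<omega> x = {y. reach E \<omega> x y}"
proof -
  have "e \<subseteq> V" if "e \<in> E" for e using assms that by (auto simp: unordered_pairs_def)
  then show ?thesis
    unfolding cluster_def open_edges_def
    using assms reach_imp_graph_path[of E \<omega> x _ V] graph_path_imp_reach[of V E \<omega>] by auto
qed

section \<open>The parent map of a tree with a fixed end\<close>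

lemma rays_tail:
  assumes "s \<in> rays V T" shows "(\<lambda>n. s (n + k)) \<in> rays V T"
  using assms unfolding rays_def by (auto simp: inj_eq intro!: injI)

lemma ray_edges_Suc: "ray_edges s = insert {s 0, s 1} (ray_edges (\<lambda>n. s (Suc n)))"
proof -
  have "{s n, s (Suc n)} \<in> insert {s 0, s 1} (ray_edges (\<lambda>n. s (Suc n)))" for n
    by (cases n) (auto simp: ray_edges_def)
  then show ?thesis by (auto simp: ray_edges_def)
qed

lemma infinite_ray_edges:
  assumes "s \<in> rays V T" shows "infinite (ray_edges s)"
proof -
  have eq: "s i = s j \<longleftrightarrow> i = j" for i j using assms by (auto simp: rays_def inj_eq)
  have "inj (\<lambda>n. {s n, s (Suc n)})"
    by (intro injI) (auto simp: doubleton_eq_iff eq)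
  then have "infinite (range (\<lambda>n. {s n, s (Suc n)}))" by (rule range_inj_infinite)
  then show ?thesis by (simp add: ray_edges_def full_SetCompr_eq)
qed

lemma end_eq:
  assumes "\<xi> \<in> graph_ends V T" "s \<in> \<xi>" 
  shows "\<xi> = {s'. (s, s') \<in> ray_equiv V T}"
proof -
  obtain r where r: "\<xi> = ray_equiv V T `` {r}" "r \<in> rays V T"
    using assms unfolding graph_ends_def by (auto elim: quotientE)
  then have "(r, s) \<in> ray_equiv V T" using assms by auto
  then have "ray_equiv V T `` {r} = ray_equiv V T `` {s}" by (rule equiv_class_eq[OF equiv_ray_equiv])
  then show ?thesis using r by auto
qed

text \<open>
  Two rays of the same end share an edge. If they started at the same vertex with different first
  steps, then following one ray up to its first later meeting with the other, and returning along
  the other, would give a cycle.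
\<close>

lemma end_ray_unique_step:
  assumes acyc: "\<nexists>xs. graph_cycle V T xs" and \<xi>: "\<xi> \<in> graph_ends V T"
    and s: "s \<in> \<xi>" "s' \<in> \<xi>" "s 0 = s' 0"
  shows "s 1 = s' 1"
proof (rule ccontr)
  assume neq: "s 1 \<noteq> s' 1"
  have "(s, s') \<in> ray_equiv V T" using end_eq[OF \<xi> s(1)] s by auto
  then have ray: "s \<in> rays V T" "s' \<in> rays V T" and fin: "finite (ray_edges s - ray_edges s')"
    by (auto simp: ray_equiv_def)
  have inj: "s i = s j \<longleftrightarrow> i = j" "s' i = s' j \<longleftrightarrow> i = j" for i j
    using ray by (auto simp: rays_def inj_eq)
  have "\<not> ray_edges s \<subseteq> ray_edges s - ray_edges s'"
    using infinite_ray_edges[OF ray(1)] fin finite_subset by blast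
  then obtain n where "{s n, s (Suc n)} \<in> ray_edges s'" by (auto simp: ray_edges_def)
  then have ex: "1 \<le> Suc n \<and> s (Suc n) \<in> range s'" by (auto simp: ray_edges_def doubleton_eq_iff)
  define n where "n = (LEAST n. 1 \<le> n \<and> s n \<in> range s')"
  have n: "n \<ge> 1" "s n \<in> range s'"
    using LeastI[of "\<lambda>n. 1 \<le> n \<and> s n \<in> range s'", OF ex] by (simp_all add: n_def)
  have min: "n \<le> i" if "1 \<le> i" "s i \<in> range s'" for i
    unfolding n_def by (rule Least_le) (use that in blast)
  obtain m where m: "s n = s' m" using n by auto
  have "m \<noteq> 0"
  proof
    assume "m = 0"
    then have "s n = s 0" using m s(3) by simp
    then show False using inj n(1) by simp
  qed
  \<comment> \<open>The common vertex \<open>s n = s' m\<close> is listed once, as a vertex of \<open>s'\<close>.\<close>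
  let ?xs = "map s [0..<n] @ rev (map s' [1..<Suc m])"
  have s1: "successively (\<lambda>u v. {u, v} \<in> T) (map s [0..<n])"
    using ray by (auto simp: successively_conv_nth rays_def)
  have s2: "successively (\<lambda>u v. {u, v} \<in> T) (rev (map s' [1..<Suc m]))"
    using ray unfolding successively_rev
    by (auto simp: successively_conv_nth rays_def insert_commute simp del: upt_Suc)
  have l1: "last (map s [0..<n]) = s (n - 1)" using n by (simp add: last_map)
  have l2: "hd (rev (map s' [1..<Suc m])) = s' m" using \<open>m \<noteq> 0\<close> by (simp add: hd_rev)
  have l3: "last ?xs = s' 1" using \<open>m \<noteq> 0\<close> by (simp add: last_rev hd_map del: upt_Suc)
  have l4: "hd ?xs = s 0" using n by (simp add: hd_append hd_map)
  have e: "{s (n - 1), s' m} \<in> T"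
  proof -
    have "{s (n - 1), s (Suc (n - 1))} \<in> T" using ray by (auto simp: rays_def)
    then show ?thesis using n(1) m by simp
  qed
  have "successively (\<lambda>u v. {u, v} \<in> T) ?xs"
    unfolding successively_append_iff using s1 s2 l1 l2 e by auto
  moreover have "s i \<noteq> s' j" if "i < n" "1 \<le> j" for i j
  proof (cases "i = 0")
    case True
    then show ?thesis using s(3) inj that by auto
  next
    case False
    then show ?thesis using min[of i] that by auto
  qed
  then have "distinct ?xs" by (auto simp: distinct_map inj_on_def inj simp del: upt_Suc)
  moreover have "set ?xs \<subseteq> V" using ray by (auto simp: rays_def)
  moreover have "?xs \<noteq> []" using n by auto
  moreover have "length ?xs \<ge> 3"
  proof -
    have "n \<noteq> 1 \<or> m \<noteq> 1" using m neq by auto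
    then show ?thesis using n \<open>m \<noteq> 0\<close> by auto
  qed
  moreover have "{last ?xs, hd ?xs} \<in> T"
    unfolding l3 l4 s(3) using ray by (auto simp: rays_def insert_commute)
  ultimately have "graph_cycle V T ?xs" unfolding graph_cycle_def graph_path_iff by blast
  then show False using acyc by blast
qed

lemma end_tail:
  assumes \<xi>: "\<xi> \<in> graph_ends V T" and s: "s \<in> \<xi>"
  shows "(\<lambda>n. s (n + k)) \<in> \<xi>"
proof (induction k)
  case (Suc k)
  let ?s = "\<lambda>n. s (n + k)"
  have ray: "?s \<in> rays V T" using end_eq[OF \<xi> Suc] Suc by (auto simp: ray_equiv_def)
  have "(\<lambda>n. s (n + Suc k)) \<in> rays V T" using rays_tail[OF ray, of 1] by simp
  moreover have "ray_edges ?s = insert {?s 0, ?s 1} (ray_edges (\<lambda>n. s (n + Suc k)))"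
    using ray_edges_Suc[of ?s] by simp
  ultimately have "(?s, (\<lambda>n. s (n + Suc k))) \<in> ray_equiv V T"
    using ray by (auto simp: ray_equiv_def insert_Diff_if)
  then show ?case using end_eq[OF \<xi> Suc] by blast
qed (use s in simp)

lemma end_cons:
  assumes \<xi>: "\<xi> \<in> graph_ends V T" and s: "s \<in> \<xi>" and y: "y \<in> V" "{y, s 0} \<in> T" "y \<notin> range s"
  shows "case_nat y s \<in> \<xi>"
proof -
  have ray: "s \<in> rays V T" using end_eq[OF \<xi> s] s by (auto simp: ray_equiv_def)
  have "case_nat y s \<in> rays V T"
    using ray y unfolding rays_def by (auto simp: inj_eq range_subsetD intro!: injI split: nat.splits)
  moreover have "ray_edges (case_nat y s) = insert {y, s 0} (ray_edges s)"
    using ray_edges_Suc[of "case_nat y s"] by simp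
  ultimately have "(s, case_nat y s) \<in> ray_equiv V T"
    using ray by (auto simp: ray_equiv_def insert_Diff_if)
  then show ?thesis using end_eq[OF \<xi> s] by blast
qed

text \<open>
  The property of starting a ray of the end passes from a vertex \<open>y\<close> to a neighbour \<open>z\<close>: if \<open>z\<close> lies
  on the ray from \<open>y\<close>, take the tail from \<open>z\<close>, and otherwise put \<open>z\<close> in front of the ray.
\<close>

lemma end_ray_exists:
  assumes conn: "connected_graph V T" and simple: "simple_graph V T"
    and \<xi>: "\<xi> \<in> graph_ends V T" and x: "x \<in> V"
  shows "\<exists>s\<in>\<xi>. s 0 = x"
proof -
  obtain r where r: "r \<in> \<xi>"
    using \<xi> unfolding graph_ends_def
    by (metis equiv_ray_equiv in_quotient_imp_non_empty ex_in_conv)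
  then have "r 0 \<in> V" using end_eq[OF \<xi> r] by (auto simp: ray_equiv_def rays_def)
  then obtain xs where xs: "graph_path V T xs" "hd xs = r 0" "last xs = x"
    using conn x unfolding connected_graph_def by blast
  have "reach T (\<lambda>_. True) (r 0) x"
    using graph_path_imp_reach[of V T "\<lambda>_. True" xs] xs by simp
  then show ?thesis
  proof (induction rule: reach_induct)
    case base
    then show ?case using r by blast
  next
    case (step y z)
    then obtain s where s: "s \<in> \<xi>" "s 0 = y" by blast
    show ?case
    proof (cases "z \<in> range s")
      case True
      then obtain k where "z = s k" by auto
      then show ?thesis using end_tail[OF \<xi> s(1), of k] by (intro bexI[of _ "\<lambda>n. s (n + k)"]) auto
    next
      case False
      have "z \<in> V" using step simple by (auto simp: simple_graph_def unordered_pairs_def doubleton_eq_iff)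
      then show ?thesis using end_cons[OF \<xi> s(1), of z] step s False
        by (intro bexI[of _ "case_nat z s"]) (auto simp: insert_commute)
    qed
  qed
qed

text \<open>
  The neighbour of \<open>x\<close> in the direction of \<open>\<xi>\<close>. In a tree it does not depend on the chosen ray,
  by \<open>end_ray_unique_step\<close>.
\<close>

definition end_parent :: "(nat \<Rightarrow> 'a) set \<Rightarrow> 'a \<Rightarrow> 'a" where
  "end_parent \<xi> x = (SOME s. s \<in> \<xi> \<and> s 0 = x) 1"

lemma end_parent_eq:
  assumes "\<nexists>xs. graph_cycle V T xs" and "\<xi> \<in> graph_ends V T" and s: "s \<in> \<xi>"
  shows "end_parent \<xi> (s n) = s (Suc n)"
proof -
  let ?s = "\<lambda>k. s (k + n)"
  have "?s \<in> \<xi>" by (rule end_tail) fact+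
  moreover from this have "(SOME s'. s' \<in> \<xi> \<and> s' 0 = s n) \<in> \<xi> \<and> (SOME s'. s' \<in> \<xi> \<and> s' 0 = s n) 0 = s n"
    by (intro someI[of "\<lambda>s'. s' \<in> \<xi> \<and> s' 0 = s n" ?s]) auto
  ultimately show ?thesis
    unfolding end_parent_def using end_ray_unique_step[OF assms(1,2), of "SOME s'. s' \<in> \<xi> \<and> s' 0 = s n" ?s] by auto
qed

lemma end_parent_funpow:
  assumes "\<nexists>xs. graph_cycle V T xs" and "\<xi> \<in> graph_ends V T" and s: "s \<in> \<xi>"
  shows "(end_parent \<xi> ^^ n) (s 0) = s n"
  by (induction n) (auto simp: end_parent_eq[OF assms])

text \<open>
  What is used of a decorated tree: a parent map \<open>par\<close> whose edges belong to \<open>E\<close>, under which every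
  vertex has \<open>d\<close> children, which has no periodic points, and for which any two vertices have a common
  ancestor; and a transitive family \<open>L\<close> of automorphisms of \<open>E\<close> commuting with \<open>par\<close>.
\<close>

locale horocyclic_graph =
  fixes V :: "'a set" and E :: "'a set set" and par :: "'a \<Rightarrow> 'a" and d :: nat and L :: "('a \<Rightarrow> 'a) set"
  assumes d: "2 \<le> d"
    and V_ne: "V \<noteq> {}"
    and E_pairs: "E \<subseteq> unordered_pairs V"
    and finite_nbrs: "x \<in> V \<Longrightarrow> finite (neighbours V E x)"
    and par_in: "x \<in> V \<Longrightarrow> par x \<in> V"
    and par_edge: "x \<in> V \<Longrightarrow> {x, par x} \<in> E"
    and card_children: "x \<in> V \<Longrightarrow> card {y\<in>V. par y = x} = d"
    and par_inj: "x \<in> V \<Longrightarrow> (par ^^ i) x = (par ^^ j) x \<Longrightarrow> i = j"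
    and par_meet: "x \<in> V \<Longrightarrow> y \<in> V \<Longrightarrow> \<exists>i j. (par ^^ i) x = (par ^^ j) y"
    and L_bij: "\<alpha> \<in> L \<Longrightarrow> bij_betw \<alpha> V V"
    and L_par: "\<alpha> \<in> L \<Longrightarrow> x \<in> V \<Longrightarrow> par (\<alpha> x) = \<alpha> (par x)"
    and L_edge: "\<alpha> \<in> L \<Longrightarrow> e \<subseteq> V \<Longrightarrow> \<alpha> ` e \<in> E \<longleftrightarrow> e \<in> E"
    and L_trans: "x \<in> V \<Longrightarrow> y \<in> V \<Longrightarrow> \<exists>\<alpha>\<in>L. \<alpha> x = y"

lemma decorated_tree_horocyclic:
  assumes d: "d \<ge> 2" and tree: "tree_graph V T" and reg: "regular_graph V T (d + 1)"
    and \<xi>: "\<xi> \<in> graph_ends V T"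
    and L: "subgroup L (BijGroup V)" "L \<subseteq> end_stabilizer V T \<xi>"
    and trans: "vertex_transitive_on L V"
    and dec: "decorated_tree V T L E"
  shows "horocyclic_graph V E (end_parent \<xi>) d L"
proof -
  let ?par = "end_parent \<xi>"
  have acyc: "\<nexists>xs. graph_cycle V T xs" and conn: "connected_graph V T" and simple: "simple_graph V T"
    using tree by (auto simp: tree_graph_def)
  obtain E' where E': "E' \<subseteq> unordered_pairs V" "{\<alpha> ` e | \<alpha> e. \<alpha> \<in> L \<and> e \<in> E'} = E'" "E = T \<union> E'"
    and lf: "locally_finite_graph V E" using dec by (auto simp: decorated_tree_def)
  have ex: "\<exists>s\<in>\<xi>. s 0 = x" if "x \<in> V" for x using end_ray_exists[OF conn simple \<xi> that] .
  have par: "?par (s n) = s (Suc n)" if "s \<in> \<xi>" for s n using end_parent_eq[OF acyc \<xi> that] .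
  have pow: "(?par ^^ n) (s 0) = s n" if "s \<in> \<xi>" for s n using end_parent_funpow[OF acyc \<xi> that] .
  have ray: "s \<in> rays V T" if "s \<in> \<xi>" for s using end_eq[OF \<xi> that] that by (auto simp: ray_equiv_def)
  have rayV: "s n \<in> V" and rayE: "{s n, s (Suc n)} \<in> T" and rayI: "s i = s j \<longleftrightarrow> i = j" if "s \<in> \<xi>" for s n i j
    using ray[OF that] by (auto simp: rays_def inj_eq)
  have par_in: "?par x \<in> V" and par_T: "{x, ?par x} \<in> T" if x: "x \<in> V" for x
  proof -
    obtain s where s: "s \<in> \<xi>" "s 0 = x" using ex[OF x] by blast
    show "?par x \<in> V" "{x, ?par x} \<in> T" using par[OF s(1), of 0] rayV[OF s(1), of 1] rayE[OF s(1), of 0] s by auto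
  qed
  have par_inj: "i = j" if x: "x \<in> V" and eq: "(?par ^^ i) x = (?par ^^ j) x" for x i j
  proof -
    obtain s where s: "s \<in> \<xi>" "s 0 = x" using ex[OF x] by blast
    then show ?thesis using eq pow[OF s(1)] rayI[OF s(1)] by auto
  qed
  have bij: "\<alpha> \<in> Bij V" "\<alpha> \<in> graph_automorphisms V T" "(\<lambda>r. \<alpha> \<circ> r) ` \<xi> = \<xi>" if "\<alpha> \<in> L" for \<alpha>
    using subsetD[OF L(2) that] by (simp_all add: end_stabilizer_def graph_automorphisms_def)
  have bb: "bij_betw \<alpha> V V" if "\<alpha> \<in> L" for \<alpha> using bij[OF that] by (auto simp: Bij_def)
  show ?thesis
  proof
    show "2 \<le> d" by fact
    show "V \<noteq> {}" using conn by (simp add: connected_graph_def)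
    show "E \<subseteq> unordered_pairs V" using simple E' by (auto simp: simple_graph_def)
    show "finite (neighbours V E x)" if "x \<in> V" for x using lf that by (simp add: locally_finite_graph_def)
    show "?par x \<in> V" "{x, ?par x} \<in> E" if "x \<in> V" for x using par_in par_T that E' by auto
    \<comment> \<open>The children of \<open>x\<close> are its neighbours in the tree other than its parent.\<close>
    show "card {y\<in>V. ?par y = x} = d" if x: "x \<in> V" for x
    proof -
      obtain s where s: "s \<in> \<xi>" "s 0 = x" using ex[OF x] by blast
      have px: "?par x = s 1" using par[OF s(1), of 0] s by simp
      have "{y\<in>V. ?par y = x} = neighbours V T x - {?par x}"
      proof (intro equalityI subsetI)
        fix y assume y: "y \<in> {y\<in>V. ?par y = x}"
        then have "{x, y} \<in> T" using par_T[of y] by (auto simp: insert_commute)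
        moreover have "y \<noteq> ?par x" using y par_inj[of x 2 0] x by (auto simp: numeral_2_eq_2)
        ultimately show "y \<in> neighbours V T x - {?par x}" using y by (auto simp: neighbours_def)
      next
        fix y assume y: "y \<in> neighbours V T x - {?par x}"
        then have yV: "y \<in> V" "{x, y} \<in> T" "y \<noteq> ?par x" by (auto simp: neighbours_def)
        have "y \<noteq> x" using yV simple by (auto simp: simple_graph_def unordered_pairs_def)
        have "y \<notin> range s"
        proof
          assume "y \<in> range s"
          then obtain n where n: "y = s n" by auto
          have "n \<noteq> 0" using n s \<open>y \<noteq> x\<close> by metis
          have "n \<noteq> 1" using n yV px by metis
          let ?xs = "map s [0..<Suc n]"
          have "successively (\<lambda>u v. {u, v} \<in> T) ?xs"
            using rayE[OF s(1)] by (auto simp: successively_conv_nth simp del: upt_Suc)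
          moreover have "distinct ?xs" by (auto simp: distinct_map inj_on_def rayI[OF s(1)] simp del: upt_Suc)
          moreover have "set ?xs \<subseteq> V" using rayV[OF s(1)] by auto
          moreover have "{last ?xs, hd ?xs} \<in> T" using yV s n by (simp add: last_map hd_map insert_commute del: upt_Suc)
          ultimately have "graph_cycle V T ?xs" unfolding graph_cycle_def graph_path_iff
            using \<open>n \<noteq> 0\<close> \<open>n \<noteq> 1\<close> by auto
          then show False using acyc by blast
        qed
        then have "case_nat y s \<in> \<xi>" using end_cons[OF \<xi> s(1), of y] yV s by (auto simp: insert_commute)
        from par[OF this, of 0] have "?par y = x" using s by simp
        then show "y \<in> {y\<in>V. ?par y = x}" using yV by simp
      qed
      moreover have "?par x \<in> neighbours V T x" using par_in par_T x by (auto simp: neighbours_def)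
      moreover have "finite (neighbours V T x)" "card (neighbours V T x) = d + 1"
        using reg x by (auto simp: regular_graph_def)
      ultimately show ?thesis by simp
    qed
    show "i = j" if "x \<in> V" "(?par ^^ i) x = (?par ^^ j) x" for x i j using par_inj that by blast
    show "\<exists>i j. (?par ^^ i) x = (?par ^^ j) y" if x: "x \<in> V" and y: "y \<in> V" for x y
    proof -
      obtain s s' where s: "s \<in> \<xi>" "s 0 = x" "s' \<in> \<xi>" "s' 0 = y" using ex x y by metis
      then have "finite (ray_edges s - ray_edges s')"
        using end_eq[OF \<xi> s(1)] by (auto simp: ray_equiv_def)
      then have "\<not> ray_edges s \<subseteq> ray_edges s - ray_edges s'"
        using infinite_ray_edges[OF ray[OF s(1)]] finite_subset by blast
      then obtain n m where "{s n, s (Suc n)} = {s' m, s' (Suc m)}" by (auto simp: ray_edges_def)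
      then have "\<exists>j. s n = s' j" by (auto simp: doubleton_eq_iff)
      then show ?thesis using pow[OF s(1), of n] pow[OF s(3)] s by metis
    qed
    show "bij_betw \<alpha> V V" if "\<alpha> \<in> L" for \<alpha> using bb that by blast
    show "?par (\<alpha> x) = \<alpha> (?par x)" if \<alpha>: "\<alpha> \<in> L" and x: "x \<in> V" for \<alpha> x
    proof -
      obtain s where s: "s \<in> \<xi>" "s 0 = x" using ex[OF x] by blast
      then have "\<alpha> \<circ> s \<in> \<xi>" using bij(3)[OF \<alpha>] by blast
      from par[OF this, of 0] par[OF s(1), of 0] show ?thesis using s by simp
    qed
    show "\<alpha> ` e \<in> E \<longleftrightarrow> e \<in> E" if \<alpha>: "\<alpha> \<in> L" and e: "e \<subseteq> V" for \<alpha> e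
    proof -
      let ?\<beta> = "inv\<^bsub>BijGroup V\<^esub> \<alpha>"
      have \<beta>: "?\<beta> \<in> L" "?\<beta> = (\<lambda>x\<in>V. (inv_into V \<alpha>) x)"
        using subgroup.m_inv_closed[OF L(1) \<alpha>] inv_BijGroup[OF bij(1)[OF \<alpha>]] by auto
      have inv: "?\<beta> ` \<alpha> ` e = e"
      proof -
        have "?\<beta> (\<alpha> x) = x" if "x \<in> e" for x
          using bb[OF \<alpha>] that e unfolding \<beta>(2) by (auto simp: bij_betw_def)
        then show ?thesis by (auto simp: image_image)
      qed
      have imp: "\<gamma> ` f \<in> E'" if "\<gamma> \<in> L" "f \<in> E'" for \<gamma> f using E'(2) that by blast
      have "\<alpha> ` e \<in> E' \<longleftrightarrow> e \<in> E'" using imp[OF \<alpha>] imp[OF \<beta>(1), of "\<alpha> ` e"] inv by auto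
      moreover have "\<alpha> ` e \<in> T \<longleftrightarrow> e \<in> T"
      proof
        assume "e \<in> T"
        then obtain x y where "e = {x, y}" "x \<in> V" "y \<in> V" using simple by (auto simp: simple_graph_def unordered_pairs_def)
        then show "\<alpha> ` e \<in> T" using bij(2)[OF \<alpha>] \<open>e \<in> T\<close> by (auto simp: graph_automorphisms_def)
      next
        assume T: "\<alpha> ` e \<in> T"
        then obtain x' y' where xy: "\<alpha> ` e = {x', y'}" using simple by (auto simp: simple_graph_def unordered_pairs_def)
        then obtain x y where x: "x \<in> e" "\<alpha> x = x'" "y \<in> e" "\<alpha> y = y'" by (metis imageE insertI1 insertI2)
        then have "\<alpha> ` e = \<alpha> ` {x, y}" using xy by auto
        moreover have "inj_on \<alpha> V" using bb[OF \<alpha>] by (simp add: bij_betw_def)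
        ultimately have "e = {x, y}" using e x by (metis inj_on_image_eq_iff empty_subsetI insert_subset subsetD)
        then show "e \<in> T" using T bij(2)[OF \<alpha>] x e by (auto simp: graph_automorphisms_def)
      qed
      ultimately show ?thesis using E' by auto
    qed
    show "\<exists>\<alpha>\<in>L. \<alpha> x = y" if "x \<in> V" "y \<in> V" for x y
      using trans that by (auto simp: vertex_transitive_on_def)
  qed
qed

section \<open>Levels, blocks and the expected number of links\<close>

context horocyclic_graph
begin

text \<open>The descendants of \<open>x\<close> at depth exactly \<open>n\<close>, at depth at most \<open>n\<close>, and at any depth.\<close>

definition level :: "'a \<Rightarrow> nat \<Rightarrow> 'a set" where
  "level x n = {y\<in>V. (par ^^ n) y = x}"

definition block :: "'a \<Rightarrow> nat \<Rightarrow> 'a set" where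
  "block x n = (\<Union>k\<le>n. level x k)"

definition desc :: "'a \<Rightarrow> 'a set" where
  "desc x = (\<Union>k. level x k)"

text \<open>The edges of the subgraph induced by \<open>S\<close>.\<close>

definition edges_in :: "'a set \<Rightarrow> 'a set set" where
  "edges_in S = {e\<in>E. e \<subseteq> S}"

text \<open>The edges of the path that climbs \<open>n\<close> steps from \<open>y\<close>.\<close>

definition up :: "'a \<Rightarrow> nat \<Rightarrow> 'a set set" where
  "up y n = (\<lambda>i. {(par ^^ i) y, (par ^^ Suc i) y}) ` {..<n}"

lemma funpow_par_in: "x \<in> V \<Longrightarrow> (par ^^ n) x \<in> V"
  by (induction n) (auto intro: par_in)

lemma funpow_plus: "(par ^^ m) ((par ^^ n) z) = (par ^^ (m + n)) z"
  by (simp add: funpow_add)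

lemma level_0: "x \<in> V \<Longrightarrow> level x 0 = {x}"
  by (auto simp: level_def)

lemma level_in_V: "level x n \<subseteq> V" and block_in_V: "block x n \<subseteq> V" and desc_in_V: "desc x \<subseteq> V"
  by (auto simp: level_def block_def desc_def)

lemma level_add: "y \<in> level x n \<Longrightarrow> z \<in> level y m \<Longrightarrow> z \<in> level x (n + m)"
  by (auto simp: level_def funpow_add)

lemma level_unique: "y \<in> level x n \<Longrightarrow> y \<in> level x m \<Longrightarrow> n = m"
  using par_inj by (auto simp: level_def)

lemma level_disjoint:
  assumes "y \<in> level x n" "y' \<in> level x n" "z \<in> level y k" "z \<in> level y' k'"
  shows "y = y'"
proof -
  have "n + k = n + k'" using level_unique level_add assms by blast
  then show ?thesis using assms by (auto simp: level_def)
qed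

lemma level_Suc: "level x (Suc n) = (\<Union>y\<in>level x n. {z\<in>V. par z = y})"
  by (auto simp: level_def funpow_swap1 intro: par_in)

lemma finite_level: "x \<in> V \<Longrightarrow> finite (level x n)"
  and card_level: "x \<in> V \<Longrightarrow> card (level x n) = d ^ n"
proof -
  have *: "finite (level x n) \<and> card (level x n) = d ^ n" if x: "x \<in> V"
  proof (induction n)
    case 0
    then show ?case using x by (simp add: level_0)
  next
    case (Suc n)
    have c: "finite {z\<in>V. par z = y}" if "y \<in> V" for y
      using card_children[OF that] d by (intro card_ge_0_finite) auto
    have "card (level x (Suc n)) = (\<Sum>y\<in>level x n. card {z\<in>V. par z = y})"
      unfolding level_Suc using Suc c level_in_V by (intro card_UN_disjoint) auto
    also have "\<dots> = (\<Sum>y\<in>level x n. d)"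
      using level_in_V by (intro sum.cong card_children) auto
    finally show ?case using Suc c level_in_V by (auto simp: level_Suc)
  qed
  show "x \<in> V \<Longrightarrow> finite (level x n)" "x \<in> V \<Longrightarrow> card (level x n) = d ^ n" using * by auto
qed

lemma finite_block: "x \<in> V \<Longrightarrow> finite (block x n)"
  by (auto simp: block_def finite_level)

lemma level_block: "k \<le> n \<Longrightarrow> level x k \<subseteq> block x n"
  and block_desc: "block x n \<subseteq> desc x"
  and block_mono: "m \<le> n \<Longrightarrow> block x m \<subseteq> block x n"
  unfolding block_def desc_def by (blast, blast, force)

lemma block_add:
  assumes "y \<in> level x n" shows "block y m \<subseteq> block x (n + m)"
proof
  fix z assume "z \<in> block y m"
  then obtain k where "k \<le> m" "z \<in> level y k" by (auto simp: block_def)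
  then have "z \<in> level x (n + k)" "n + k \<le> n + m" using level_add assms by auto
  then show "z \<in> block x (n + m)" by (auto simp: block_def)
qed

lemma block_level_Int:
  assumes "y \<in> level x n" shows "block x n \<inter> block y m \<subseteq> {y}"
proof
  fix z assume z: "z \<in> block x n \<inter> block y m"
  then obtain i k where i: "i \<le> n" "z \<in> level x i" and k: "k \<le> m" "z \<in> level y k" by (auto simp: block_def)
  then have "z \<in> level x (n + k)" using level_add assms by auto
  then have "i = n + k" using i level_unique by blast
  then have "k = 0" using i by simp
  then show "z \<in> {y}" using k by (auto simp: level_def)
qed

lemma edge_in_V: "e \<in> E \<Longrightarrow> e \<subseteq> V"
  using E_pairs by (auto simp: unordered_pairs_def)

lemma edges_in_sub: "edges_in S \<subseteq> E" and edges_in_mono: "S \<subseteq> S' \<Longrightarrow> edges_in S \<subseteq> edges_in S'"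
  by (auto simp: edges_in_def)

lemma finite_edges_in: "finite S \<Longrightarrow> finite (edges_in S)"
  by (rule finite_subset[of _ "Pow S"]) (auto simp: edges_in_def)

lemma edges_in_disjoint: "S \<inter> S' \<subseteq> {y} \<Longrightarrow> edges_in S \<inter> edges_in S' = {}"
proof (rule ccontr)
  assume S: "S \<inter> S' \<subseteq> {y}" and "edges_in S \<inter> edges_in S' \<noteq> {}"
  then obtain e where e: "e \<in> E" "e \<subseteq> S" "e \<subseteq> S'" by (auto simp: edges_in_def)
  then obtain u v where "e = {u, v}" "u \<noteq> v" using E_pairs by (auto simp: unordered_pairs_def)
  then show False using e S by auto
qed

lemma up_edges:
  assumes "y \<in> level w m" "w \<in> level x k"
  shows "up y m \<subseteq> edges_in (block x (k + m))"
proof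
  fix e assume "e \<in> up y m"
  then obtain i where i: "i < m" "e = {(par ^^ i) y, (par ^^ Suc i) y}" by (auto simp: up_def)
  have y: "y \<in> V" using assms by (auto simp: level_def)
  have *: "(par ^^ j) y \<in> level x (k + m - j)" if "j \<le> m" for j
  proof -
    have "(par ^^ (k + m - j)) ((par ^^ j) y) = (par ^^ (k + m)) y"
      using that by (simp flip: funpow_add comp_apply[of "par ^^ _"])
    then show ?thesis using level_add[OF assms(2,1)] y by (auto simp: level_def funpow_par_in)
  qed
  have "e \<subseteq> block x (k + m)" using *[of i] *[of "Suc i"] i by (auto simp: block_def)
  moreover have "e \<in> E" using par_edge[OF funpow_par_in[OF y, of i]] i by simp
  ultimately show "e \<in> edges_in (block x (k + m))" by (auto simp: edges_in_def)
qed

lemma card_up_le: "card (up y n) \<le> n"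
  unfolding up_def using card_image_le[of "{..<n}"] by force

lemma reach_up:
  assumes "\<forall>e\<in>up y n. \<omega> e" "up y n \<subseteq> F"
  shows "reach F \<omega> y ((par ^^ n) y)"
  using assms
proof (induction n)
  case (Suc n)
  have "up y (Suc n) = insert {(par ^^ n) y, (par ^^ Suc n) y} (up y n)"
    by (simp add: up_def lessThan_Suc)
  then have "reach F \<omega> y ((par ^^ n) y)" "reach F \<omega> ((par ^^ n) y) ((par ^^ Suc n) y)"
    using Suc by (auto intro: reach_edge)
  then show ?case by (rule reach_trans)
qed simp

lemma L_in: "\<alpha> \<in> L \<Longrightarrow> x \<in> V \<Longrightarrow> \<alpha> x \<in> V"
  using L_bij by (auto simp: bij_betw_def)

lemma L_funpow: "\<alpha> \<in> L \<Longrightarrow> x \<in> V \<Longrightarrow> (par ^^ n) (\<alpha> x) = \<alpha> ((par ^^ n) x)"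
  by (induction n) (auto simp: L_par funpow_par_in)

lemma level_image:
  assumes \<alpha>: "\<alpha> \<in> L" and x: "x \<in> V" shows "level (\<alpha> x) n = \<alpha> ` level x n"
proof (intro equalityI subsetI)
  fix y assume "y \<in> level (\<alpha> x) n"
  then have y: "y \<in> V" "(par ^^ n) y = \<alpha> x" by (auto simp: level_def)
  then obtain z where z: "z \<in> V" "y = \<alpha> z" using L_bij[OF \<alpha>] by (auto simp: bij_betw_def)
  then have "\<alpha> ((par ^^ n) z) = \<alpha> x" using L_funpow[OF \<alpha>] y by simp
  then have "(par ^^ n) z = x"
    using L_bij[OF \<alpha>] x z by (auto simp: bij_betw_def inj_on_def funpow_par_in)
  then show "y \<in> \<alpha> ` level x n" using z by (auto simp: level_def)
qed (auto simp: level_def L_funpow[OF \<alpha>] L_in[OF \<alpha>])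

lemma block_image: "\<alpha> \<in> L \<Longrightarrow> x \<in> V \<Longrightarrow> block (\<alpha> x) n = \<alpha> ` block x n"
  and desc_image: "\<alpha> \<in> L \<Longrightarrow> x \<in> V \<Longrightarrow> desc (\<alpha> x) = \<alpha> ` desc x"
  by (auto simp: block_def desc_def level_image)

lemma bij_edges:
  assumes \<alpha>: "\<alpha> \<in> L" shows "bij_betw ((`) \<alpha>) E E"
proof -
  have "inj_on ((`) \<alpha>) (Pow V)" using L_bij[OF \<alpha>] by (intro inj_on_image_Pow) (auto simp: bij_betw_def)
  then have "inj_on ((`) \<alpha>) E" by (rule inj_on_subset) (use edge_in_V in auto)
  moreover have "(`) \<alpha> ` E = E"
  proof (intro equalityI subsetI)
    fix e assume e: "e \<in> E"
    then have "e \<subseteq> \<alpha> ` V" using edge_in_V L_bij[OF \<alpha>] by (auto simp: bij_betw_def)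
    then obtain f where "f \<subseteq> V" "e = \<alpha> ` f" by (auto simp: subset_image_iff)
    then show "e \<in> (`) \<alpha> ` E" using e L_edge[OF \<alpha>] by auto
  qed (use L_edge[OF \<alpha>] edge_in_V in auto)
  ultimately show ?thesis by (simp add: bij_betw_def)
qed

lemma countable_V: "countable V"
proof -
  obtain x where x: "x \<in> V" using V_ne by auto
  have "V \<subseteq> (\<Union>i. \<Union>j. level ((par ^^ j) x) i)"
  proof
    fix y assume y: "y \<in> V"
    then obtain i j where "(par ^^ i) y = (par ^^ j) x" using par_meet x by metis
    then show "y \<in> (\<Union>i. \<Union>j. level ((par ^^ j) x) i)" using y by (auto simp: level_def)
  qed
  moreover have "countable (\<Union>i. \<Union>j. level ((par ^^ j) x) i)"
    using countable_finite[OF finite_level[OF funpow_par_in[OF x]]] by blast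
  ultimately show ?thesis by (rule countable_subset)
qed

lemma countable_E: "countable E"
proof (rule countable_subset)
  show "E \<subseteq> (\<lambda>(x, y). {x, y}) ` (V \<times> V)" using E_pairs by (force simp: unordered_pairs_def)
  show "countable ((\<lambda>(x, y). {x, y}) ` (V \<times> V))" using countable_V by auto
qed

text \<open>
  A uniform bound on edges: the end points of each edge have a common ancestor less than \<open>R\<close>
  generations above both of them.
\<close>

definition edge_range :: "nat \<Rightarrow> bool" where
  "edge_range R \<longleftrightarrow> 1 \<le> R \<and> (\<forall>u v. {u, v} \<in> E \<longrightarrow> (\<exists>i<R. \<exists>j<R. (par ^^ i) u = (par ^^ j) v))"

lemma edges_short:
  obtains R where "edge_range R"
proof -
  obtain x where x: "x \<in> V" using V_ne by auto
  have "\<forall>v\<in>neighbours V E x. \<exists>r. \<exists>i<r. \<exists>j<r. (par ^^ i) x = (par ^^ j) v"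
  proof
    fix v assume "v \<in> neighbours V E x"
    then obtain i j where "(par ^^ i) x = (par ^^ j) v" using par_meet[OF x, of v] by (auto simp: neighbours_def)
    then show "\<exists>r. \<exists>i<r. \<exists>j<r. (par ^^ i) x = (par ^^ j) v"
      by (intro exI[of _ "Suc (max i j)"] exI[of _ i] conjI exI[of _ j]) auto
  qed
  then obtain r where r: "\<forall>v\<in>neighbours V E x. \<exists>i<r v. \<exists>j<r v. (par ^^ i) x = (par ^^ j) v" by metis
  define R where "R = Suc (Max (r ` neighbours V E x))"
  have le: "r v \<le> R" if "v \<in> neighbours V E x" for v
    using that finite_nbrs[OF x] by (auto simp: R_def intro: le_SucI)
  have "\<exists>i<R. \<exists>j<R. (par ^^ i) u = (par ^^ j) v" if e: "{u, v} \<in> E" for u v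
  proof -
    have uv: "u \<in> V" "v \<in> V" using e edge_in_V by auto
    obtain \<alpha> where \<alpha>: "\<alpha> \<in> L" "\<alpha> x = u" using L_trans[OF x uv(1)] by blast
    have "v \<in> \<alpha> ` V" using bij_betw_imp_surj_on[OF L_bij[OF \<alpha>(1)]] uv by simp
    then obtain w where w: "w \<in> V" "\<alpha> w = v" by blast
    have "{x, w} \<in> E" using L_edge[OF \<alpha>(1), of "{x, w}"] e \<alpha> w x by auto
    then have wn: "w \<in> neighbours V E x" using w by (simp add: neighbours_def)
    then obtain i j where ij: "i < r w" "j < r w" "(par ^^ i) x = (par ^^ j) w" using r by blast
    then have "(par ^^ i) u = (par ^^ j) v"
      using L_funpow[OF \<alpha>(1) x, of i] L_funpow[OF \<alpha>(1) w(1), of j] \<alpha> w by simp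
    then show ?thesis using ij le[OF wn] by (meson less_le_trans)
  qed
  moreover have "1 \<le> R" by (simp add: R_def)
  ultimately show ?thesis using that unfolding edge_range_def by blast
qed

text \<open>The event that \<open>x\<close> is joined to \<open>y\<close> by an open path inside \<open>block x n\<close>.\<close>

definition link :: "'a \<Rightarrow> nat \<Rightarrow> 'a \<Rightarrow> ('a set \<Rightarrow> bool) \<Rightarrow> bool" where
  "link x n y \<omega> = reach (edges_in (block x n)) \<omega> x y"

lemma depends_on_link: "depends_on (edges_in (block x n)) (link x n y)"
  unfolding link_def by (rule depends_on_reach)

lemma finite_edges_block: "x \<in> V \<Longrightarrow> finite (edges_in (block x n))"
  by (intro finite_edges_in finite_block)

lemma measurable_link: "x \<in> V \<Longrightarrow> {\<omega> \<in> space (percolation E p). link x n y \<omega>} \<in> sets (percolation E p)"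
  using measurable_depends_on[OF finite_edges_block edges_in_sub depends_on_link] .

text \<open>The expected number of descendants of \<open>x\<close> at depth \<open>n\<close> that \<open>x\<close> is linked to.\<close>

definition mean :: "'a \<Rightarrow> nat \<Rightarrow> real \<Rightarrow> real" where
  "mean x n p = (\<Sum>y\<in>level x n. \<P>(\<omega> in percolation E p. link x n y \<omega>))"

text \<open>Applied to all \<open>\<alpha>\<close> in the transitive family \<open>L\<close>, this gives that \<open>mean x n p\<close> is independent of \<open>x\<close>.\<close>

lemma mean_le_mean_image:
  assumes \<alpha>: "\<alpha> \<in> L" and x: "x \<in> V" and p: "0 \<le> p" "p \<le> 1"
  shows "mean x n p \<le> mean (\<alpha> x) n p"
proof -
  interpret prob_space "percolation E p" by (rule prob_space_percolation)
  have inj: "inj_on \<alpha> (level x n)"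
    using L_bij[OF \<alpha>] level_in_V by (auto simp: bij_betw_def intro: inj_on_subset)
  have "\<P>(\<omega> in percolation E p. link x n y \<omega>) \<le> \<P>(\<omega> in percolation E p. link (\<alpha> x) n (\<alpha> y) \<omega>)" for y
  proof -
    have im: "\<alpha> ` e \<in> edges_in (block (\<alpha> x) n)" if "e \<in> edges_in (block x n)" for e
      using that L_edge[OF \<alpha>, of e] edge_in_V[of e] unfolding edges_in_def block_image[OF \<alpha> x] by auto
    have "link (\<alpha> x) n (\<alpha> y) \<omega>" if "link x n y (\<lambda>e. \<omega> (\<alpha> ` e))" for \<omega>
      using that unfolding link_def by (rule reach_image) (rule im)
    then have "\<P>(\<omega> in percolation E p. link x n y (\<lambda>e. \<omega> (\<alpha> ` e))) \<le> \<P>(\<omega> in percolation E p. link (\<alpha> x) n (\<alpha> y) \<omega>)"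
      using measurable_link[OF L_in[OF \<alpha> x]] by (intro finite_measure_mono) auto
    moreover have "\<P>(\<omega> in percolation E p. link x n y (\<lambda>e. \<omega> (\<alpha> ` e))) = \<P>(\<omega> in percolation E p. link x n y \<omega>)"
      by (rule prob_reindex[OF finite_edges_block[OF x] edges_in_sub depends_on_link bij_edges[OF \<alpha>] p])
    ultimately show ?thesis by simp
  qed
  then show ?thesis
    unfolding mean_def level_image[OF \<alpha> x] by (subst sum.reindex[OF inj]) (auto intro!: sum_mono)
qed

lemma continuous_mean: "x \<in> V \<Longrightarrow> continuous_on {0..1} (mean x n)"
  unfolding mean_def
  by (intro continuous_on_sum continuous_prob[OF finite_edges_block edges_in_sub depends_on_link])

lemma measurable_infinite_cluster:
  "F \<subseteq> E \<Longrightarrow> x \<in> V \<Longrightarrow> {\<omega> \<in> space (percolation E p). infinite {y. reach F \<omega> x y}} \<in> sets (percolation E p)"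
  using edge_in_V by (intro measurable_infinite_reach[of E F V] countable_E countable_V) auto

lemma has_infinite_cluster_iff:
  "has_infinite_cluster V E \<omega> \<longleftrightarrow> (\<exists>x\<in>V. infinite {y. reach E \<omega> x y})"
  unfolding has_infinite_cluster_def using cluster_eq[OF E_pairs] by simp

lemma measurable_has_infinite_cluster:
  "{\<omega> \<in> space (percolation E p). has_infinite_cluster V E \<omega>} \<in> sets (percolation E p)"
  unfolding has_infinite_cluster_iff
  by (intro sets.sets_Collect_countable_Ex' measurable_infinite_cluster countable_V) auto

end

section \<open>Mean larger than one implies an infinite cluster\<close>

lemma one_minus_power_ge:
  fixes \<delta> :: real
  assumes "0 \<le> \<delta>" "\<delta> \<le> 1"
  shows "real u * \<delta> - (real u)\<^sup>2 * \<delta>\<^sup>2 \<le> 1 - (1 - \<delta>) ^ u"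
proof (induction u)
  case (Suc u)
  have "(1 - \<delta>) ^ Suc u \<le> (1 - \<delta>) * (1 - real u * \<delta> + (real u)\<^sup>2 * \<delta>\<^sup>2)"
    using Suc assms by (auto intro!: mult_left_mono)
  also have "\<dots> = 1 - real (Suc u) * \<delta> + (real u)\<^sup>2 * \<delta>\<^sup>2 + real u * \<delta>\<^sup>2 - (real u)\<^sup>2 * \<delta>\<^sup>2 * \<delta>"
    by (simp add: algebra_simps power2_eq_square)
  also have "\<dots> \<le> 1 - real (Suc u) * \<delta> + (real (Suc u))\<^sup>2 * \<delta>\<^sup>2"
  proof -
    have "(real (Suc u))\<^sup>2 * \<delta>\<^sup>2 = (real u)\<^sup>2 * \<delta>\<^sup>2 + 2 * (real u * \<delta>\<^sup>2) + \<delta>\<^sup>2"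
      by (simp add: algebra_simps power2_eq_square)
    moreover have "0 \<le> (real u)\<^sup>2 * \<delta>\<^sup>2 * \<delta>" "0 \<le> real u * \<delta>\<^sup>2" "0 \<le> \<delta>\<^sup>2" using assms by auto
    ultimately show ?thesis by linarith
  qed
  finally show ?case by linarith
qed simp

context horocyclic_graph
begin

text \<open>The event that \<open>x\<close> is linked, inside \<open>block x N\<close>, to some vertex at depth \<open>N\<close>.\<close>

definition hits :: "nat \<Rightarrow> 'a \<Rightarrow> ('a set \<Rightarrow> bool) \<Rightarrow> bool" where
  "hits N x \<omega> \<longleftrightarrow> (\<exists>y\<in>level x N. link x N y \<omega>)"

lemma depends_on_hits: "depends_on (edges_in (block x N)) (hits N x)"
  unfolding hits_def by (intro depends_on_bex depends_on_link)

lemma measurable_hits: "x \<in> V \<Longrightarrow> {\<omega> \<in> space (percolation E p). hits N x \<omega>} \<in> sets (percolation E p)"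
  using measurable_depends_on[OF finite_edges_block edges_in_sub depends_on_hits] .

lemma hits_add:
  assumes "y \<in> level x n" "link x n y \<omega>" "hits N y \<omega>"
  shows "hits (n + N) x \<omega>"
proof -
  obtain z where z: "z \<in> level y N" "link y N z \<omega>" using assms by (auto simp: hits_def)
  have "reach (edges_in (block x (n + N))) \<omega> x y"
    using assms(2) unfolding link_def by (rule reach_mono) (simp_all add: edges_in_mono block_mono)
  moreover have "reach (edges_in (block x (n + N))) \<omega> y z"
    using z(2) unfolding link_def by (rule reach_mono) (simp_all add: edges_in_mono block_add[OF assms(1)])
  ultimately show ?thesis
    using level_add[OF assms(1) z(1)] by (auto simp: hits_def link_def intro: reach_trans)
qed

lemma edges_in_blocks_disjoint:
  assumes "y \<in> level x n" "y' \<in> level x n" "y \<noteq> y'"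
  shows "edges_in (block y m) \<inter> edges_in (block y' m) = {}"
proof (rule edges_in_disjoint[where y = y])
  show "block y m \<inter> block y' m \<subseteq> {y}"
    using level_disjoint[OF assms(1,2)] assms(3) by (auto simp: block_def)
qed

lemma prob_no_hits:
  assumes x: "x \<in> V" and U: "U \<subseteq> level x n" and p: "0 \<le> p" "p \<le> 1"
  shows "\<P>(\<omega> in percolation E p. \<forall>y\<in>U. \<not> hits N y \<omega>) = (\<Prod>y\<in>U. 1 - \<P>(\<omega> in percolation E p. hits N y \<omega>))"
proof -
  interpret prob_space "percolation E p" by (rule prob_space_percolation)
  have UV: "U \<subseteq> V" and fin: "finite U" using U level_in_V finite_level[OF x] by (auto intro: finite_subset)
  have "\<P>(\<omega> in percolation E p. \<forall>y\<in>U. \<not> hits N y \<omega>) = (\<Prod>y\<in>U. \<P>(\<omega> in percolation E p. \<not> hits N y \<omega>))"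
  proof (rule prob_indep_family[where F = "\<lambda>y. edges_in (block y N)"])
    show "disjoint_family_on (\<lambda>y. edges_in (block y N)) U"
      unfolding disjoint_family_on_def using edges_in_blocks_disjoint[OF subsetD[OF U] subsetD[OF U]] by blast
  qed (use UV fin p in \<open>auto intro!: finite_edges_block depends_on_not depends_on_hits subsetD[OF edges_in_sub]\<close>)
  also have "\<dots> = (\<Prod>y\<in>U. 1 - \<P>(\<omega> in percolation E p. hits N y \<omega>))"
    using UV by (intro prod.cong refl prob_neg measurable_hits) auto
  finally show ?thesis .
qed

lemma prob_no_hits_le:
  assumes x: "x \<in> V" and U: "U \<subseteq> level x n" and p: "0 \<le> p" "p \<le> 1"
    and \<delta>: "\<And>y. y \<in> V \<Longrightarrow> \<delta> \<le> \<P>(\<omega> in percolation E p. hits N y \<omega>)"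
  shows "\<P>(\<omega> in percolation E p. \<forall>y\<in>U. \<not> hits N y \<omega>) \<le> (1 - \<delta>) ^ card U"
proof -
  interpret prob_space "percolation E p" by (rule prob_space_percolation)
  have "(\<Prod>y\<in>U. 1 - \<P>(\<omega> in percolation E p. hits N y \<omega>)) \<le> (\<Prod>y\<in>U. 1 - \<delta>)"
    using U level_in_V \<delta> by (intro prod_mono) (auto simp: subset_iff)
  then show ?thesis unfolding prob_no_hits[OF assms(1-4)] by simp
qed

text \<open>
  One generation of the branching process. Let \<open>Y\<close> be the random set of vertices at depth \<open>n\<close> linked
  to \<open>x\<close>. Given \<open>Y = U\<close>, the attempts to descend a further \<open>N\<close> levels from the vertices of \<open>U\<close> are
  independent, so one of them succeeds with probability at least
  \<open>1 - (1 - \<delta>) ^ card U \<ge> \<delta> * card U - (card U)\<^sup>2 * \<delta>\<^sup>2\<close>. The right-hand side is averaged over \<open>U\<close>,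
  using \<open>card U \<le> d ^ n\<close> in the quadratic term.
\<close>

lemma hits_step:
  assumes p: "0 \<le> p" "p \<le> 1" and x: "x \<in> V" and \<delta>: "0 \<le> \<delta>" "\<delta> \<le> 1"
    and hyp: "\<And>y. y \<in> V \<Longrightarrow> \<delta> \<le> \<P>(\<omega> in percolation E p. hits N y \<omega>)"
  shows "\<delta> * mean x n p - (real (d ^ n))\<^sup>2 * \<delta>\<^sup>2 \<le> \<P>(\<omega> in percolation E p. hits (n + N) x \<omega>)"
proof -
  interpret prob_space "percolation E p" by (rule prob_space_percolation)
  let ?M = "percolation E p" and ?S = "level x n" and ?F = "edges_in (block x n)"
  let ?Y = "\<lambda>\<omega>. {y\<in>level x n. link x n y \<omega>}"
  have S: "finite ?S" "card ?S = d ^ n" using finite_level[OF x] card_level[OF x] by auto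
  have yV: "y \<in> V" if "y \<in> ?S" for y using that level_in_V by auto
  have F: "finite ?F" "?F \<subseteq> E" using finite_edges_block[OF x] edges_in_sub by auto
  have dep: "depends_on ?F (\<lambda>\<omega>. ?Y \<omega> = U)" for U by (intro depends_on_Collect_eq depends_on_link)
  have term_le: "\<P>(\<omega> in ?M. ?Y \<omega> = U) * (\<delta> * card U - (real (d ^ n))\<^sup>2 * \<delta>\<^sup>2)
     \<le> \<P>(\<omega> in ?M. ?Y \<omega> = U \<and> (\<exists>y\<in>U. hits N y \<omega>))" if U: "U \<in> Pow ?S" for U
  proof -
    let ?G = "\<Union>y\<in>U. edges_in (block y N)"
    have UV: "U \<subseteq> V" and fU: "finite U" using U level_in_V S by (auto intro: finite_subset)
    have G: "finite ?G" "?G \<subseteq> E" using fU UV finite_edges_block by (auto simp: edges_in_def)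
    have d1: "depends_on ?G (\<lambda>\<omega>. \<exists>y\<in>U. hits N y \<omega>)"
      by (intro depends_on_bex depends_on_mono[OF depends_on_hits]) auto
    have dj: "?F \<inter> ?G = {}"
    proof -
      have "?F \<inter> edges_in (block y N) = {}" if "y \<in> U" for y
        using U that by (intro edges_in_disjoint[where y = y] block_level_Int) auto
      then show ?thesis by blast
    qed
    have "card U \<le> d ^ n" using card_mono[OF S(1), of U] U S(2) by auto
    then have "real (card U) \<le> real (d ^ n)" by (rule of_nat_mono)
    then have "(real (card U))\<^sup>2 * \<delta>\<^sup>2 \<le> (real (d ^ n))\<^sup>2 * \<delta>\<^sup>2"
      by (intro mult_right_mono power_mono) auto
    then have "\<delta> * card U - (real (d ^ n))\<^sup>2 * \<delta>\<^sup>2 \<le> 1 - (1 - \<delta>) ^ card U"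
      using one_minus_power_ge[OF \<delta>, of "card U"] by (simp add: mult.commute)
    also have "\<dots> \<le> 1 - \<P>(\<omega> in ?M. \<forall>y\<in>U. \<not> hits N y \<omega>)"
      using prob_no_hits_le[OF x _ p hyp, of U] U by auto
    also have "\<dots> = \<P>(\<omega> in ?M. \<exists>y\<in>U. hits N y \<omega>)"
      using prob_neg[OF measurable_depends_on[OF G d1]] by simp
    finally have "\<P>(\<omega> in ?M. ?Y \<omega> = U) * (\<delta> * card U - (real (d ^ n))\<^sup>2 * \<delta>\<^sup>2)
        \<le> \<P>(\<omega> in ?M. ?Y \<omega> = U) * \<P>(\<omega> in ?M. \<exists>y\<in>U. hits N y \<omega>)"
      by (intro mult_left_mono) auto
    also have "\<dots> = \<P>(\<omega> in ?M. ?Y \<omega> = U \<and> (\<exists>y\<in>U. hits N y \<omega>))"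
      by (rule prob_indep[OF F dep G d1 dj p, symmetric])
    finally show ?thesis .
  qed
  have mR: "{\<omega> \<in> space ?M. \<exists>y\<in>?S. link x n y \<omega> \<and> hits N y \<omega>} \<in> sets ?M"
    using S yV x by (intro sets.sets_Collect_finite_Ex sets.sets_Collect_conj measurable_link measurable_hits)
  have one: "(\<Sum>U\<in>Pow ?S. \<P>(\<omega> in ?M. ?Y \<omega> = U)) = 1"
    using prob_partition[OF S(1) F, of "\<lambda>y. link x n y" p "\<lambda>_. True"] depends_on_link
    by (simp add: prob_space)
  have "\<delta> * mean x n p - (real (d ^ n))\<^sup>2 * \<delta>\<^sup>2
      = (\<Sum>U\<in>Pow ?S. \<P>(\<omega> in ?M. ?Y \<omega> = U) * (\<delta> * card U - (real (d ^ n))\<^sup>2 * \<delta>\<^sup>2))"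
  proof -
    have "mean x n p = (\<Sum>U\<in>Pow ?S. \<P>(\<omega> in ?M. ?Y \<omega> = U) * card U)"
      unfolding mean_def by (intro sum_prob_eq_sum_card[OF S(1) F] depends_on_link)
    then have "\<delta> * mean x n p - (real (d ^ n))\<^sup>2 * \<delta>\<^sup>2
      = \<delta> * (\<Sum>U\<in>Pow ?S. \<P>(\<omega> in ?M. ?Y \<omega> = U) * card U)
        - (\<Sum>U\<in>Pow ?S. \<P>(\<omega> in ?M. ?Y \<omega> = U)) * ((real (d ^ n))\<^sup>2 * \<delta>\<^sup>2)"
      using one by simp
    also have "\<dots> = (\<Sum>U\<in>Pow ?S. \<P>(\<omega> in ?M. ?Y \<omega> = U) * (\<delta> * card U - (real (d ^ n))\<^sup>2 * \<delta>\<^sup>2))"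
      unfolding sum_distrib_left sum_distrib_right sum_subtractf[symmetric]
      by (intro sum.cong refl) (simp only: right_diff_distrib mult.left_commute)
    finally show ?thesis .
  qed
  also have "\<dots> \<le> (\<Sum>U\<in>Pow ?S. \<P>(\<omega> in ?M. ?Y \<omega> = U \<and> (\<exists>y\<in>U. hits N y \<omega>)))"
    by (intro sum_mono term_le)
  also have "\<dots> = (\<Sum>U\<in>Pow ?S. \<P>(\<omega> in ?M. ?Y \<omega> = U \<and> (\<exists>y\<in>?S. link x n y \<omega> \<and> hits N y \<omega>)))"
    by (intro sum.cong refl arg_cong[where f = "measure ?M"]) blast
  also have "\<dots> = \<P>(\<omega> in ?M. \<exists>y\<in>?S. link x n y \<omega> \<and> hits N y \<omega>)"
    using prob_partition[OF S(1) F _ mR, of "link x n"] depends_on_link by simp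
  also have "\<dots> \<le> \<P>(\<omega> in ?M. hits (n + N) x \<omega>)"
    using x hits_add by (intro finite_measure_mono measurable_hits) auto
  finally show ?thesis .
qed

lemma hits_bounded_below:
  assumes p: "0 \<le> p" "p \<le> 1" and m: "1 < m" "\<And>x. x \<in> V \<Longrightarrow> m \<le> mean x n p"
  obtains \<delta> where "0 < \<delta>" "\<delta> \<le> 1" "\<And>k x. x \<in> V \<Longrightarrow> \<delta> \<le> \<P>(\<omega> in percolation E p. hits (k * n) x \<omega>)"
proof -
  interpret prob_space "percolation E p" by (rule prob_space_percolation)
  let ?D = "(real (d ^ n))\<^sup>2"
  \<comment> \<open>With this \<open>\<delta>\<close>, \<open>hits_step\<close> reproduces the lower bound \<open>\<delta>\<close>, as \<open>\<delta> * m - ?D * \<delta>\<^sup>2 \<ge> \<delta>\<close>.\<close>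
  define \<delta> where "\<delta> = min 1 ((m - 1) / ?D)"
  have D: "?D > 0" using d by simp
  have \<delta>: "0 < \<delta>" "\<delta> \<le> 1" using D m unfolding \<delta>_def by auto
  have "\<delta> * ?D \<le> m - 1" using D by (simp add: \<delta>_def min_def field_simps)
  then have "\<delta> * (\<delta> * ?D) \<le> \<delta> * (m - 1)" using \<delta> by (intro mult_left_mono) auto
  then have ineq: "\<delta> \<le> \<delta> * m - ?D * \<delta>\<^sup>2" by (simp add: algebra_simps power2_eq_square)
  have "\<delta> \<le> \<P>(\<omega> in percolation E p. hits (k * n) x \<omega>)" if "x \<in> V" for k x
    using that
  proof (induction k arbitrary: x)
    case 0
    then have "hits 0 x \<omega>" for \<omega> by (auto simp: hits_def level_0 link_def)
    then show ?case using \<delta> by (simp add: prob_space)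
  next
    case (Suc k)
    have "\<delta> \<le> \<delta> * m - ?D * \<delta>\<^sup>2" by (rule ineq)
    also have "\<dots> \<le> \<delta> * mean x n p - ?D * \<delta>\<^sup>2" using m(2)[OF Suc.prems] \<delta> by (simp add: mult_left_mono)
    also have "\<dots> \<le> \<P>(\<omega> in percolation E p. hits (n + k * n) x \<omega>)"
      using \<delta> Suc by (intro hits_step p) auto
    finally show ?case by simp
  qed
  then show ?thesis using that \<delta> by blast
qed

lemma finitely_many_hits:
  assumes "finite {z. reach E \<omega> y z}" "0 < n"
  shows "finite {k. hits (k * n) y \<omega>}"
proof (rule finite_subset)
  show "{k. hits (k * n) y \<omega>} \<subseteq> (\<Union>z\<in>{z. reach E \<omega> y z}. {k. z \<in> level y (k * n)})"
    using edges_in_sub reach_mono[of _ \<omega> y _ E \<omega>] unfolding hits_def link_def by blast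
  have "finite {k. z \<in> level y (k * n)}" for z
  proof -
    have "k = l" if "z \<in> level y (k * n)" "z \<in> level y (l * n)" for k l
      using level_unique[OF that] assms(2) by simp
    then have "{k. z \<in> level y (k * n)} \<subseteq> {SOME k. z \<in> level y (k * n)}"
      by (auto intro: someI2)
    then show ?thesis by (rule finite_subset) simp
  qed
  then show "finite (\<Union>z\<in>{z. reach E \<omega> y z}. {k. z \<in> level y (k * n)})" using assms(1) by auto
qed

theorem supercritical_of_mean:
  assumes p: "0 \<le> p" "p \<le> 1" and x0: "x0 \<in> V" "1 < mean x0 n p"
  shows "\<P>(\<omega> in percolation E p. has_infinite_cluster V E \<omega>) = 1"
proof -
  interpret prob_space "percolation E p" by (rule prob_space_percolation)
  let ?M = "percolation E p"
  have m: "mean x0 n p \<le> mean x n p" if "x \<in> V" for x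
    using L_trans[OF x0(1) that] mean_le_mean_image[OF _ x0(1) p] by blast
  obtain \<delta> where \<delta>: "0 < \<delta>" "\<delta> \<le> 1"
    and hits: "\<And>k x. x \<in> V \<Longrightarrow> \<delta> \<le> \<P>(\<omega> in ?M. hits (k * n) x \<omega>)"
    using hits_bounded_below[OF p x0(2) m] by blast
  have n: "0 < n"
  proof (rule ccontr)
    assume "\<not> 0 < n"
    then have "mean x0 n p = 1" using x0(1) by (simp add: mean_def level_0 link_def prob_space)
    then show False using x0(2) by simp
  qed
  have bound: "\<P>(\<omega> in ?M. \<not> has_infinite_cluster V E \<omega>) \<le> (1 - \<delta>) ^ k" for k
  proof -
    let ?A = "\<lambda>j \<omega>. \<forall>y\<in>level x0 k. \<not> hits (j * n) y \<omega>"
    let ?G = "\<lambda>i. {\<omega> \<in> space ?M. \<forall>j\<in>{i..}. ?A j \<omega>}"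
    have mA: "{\<omega> \<in> space ?M. ?A j \<omega>} \<in> sets ?M" for j
      using finite_level[OF x0(1)] level_in_V
      by (intro sets.sets_Collect_countable_All' sets.sets_Collect_neg measurable_hits) (auto intro: countable_finite)
    have mG: "?G i \<in> sets ?M" for i
      by (intro sets.sets_Collect_countable_All' mA) auto
    have Gle: "measure ?M (?G i) \<le> (1 - \<delta>) ^ k" for i
    proof -
      have "measure ?M (?G i) \<le> \<P>(\<omega> in ?M. ?A i \<omega>)" by (intro finite_measure_mono mA) auto
      also have "\<dots> \<le> (1 - \<delta>) ^ card (level x0 k)"
        by (rule prob_no_hits_le[OF x0(1) subset_refl p hits])
      also have "\<dots> \<le> (1 - \<delta>) ^ k"
      proof (rule power_decreasing)
        have "k < 2 ^ k" by simp
        also have "(2::nat) ^ k \<le> d ^ k" using d by (rule power_mono) simp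
        finally show "k \<le> card (level x0 k)" using card_level[OF x0(1)] by simp
      qed (use \<delta> in auto)
      finally show ?thesis .
    qed
    \<comment> \<open>Without infinite clusters, all descents from level \<open>k\<close> fail from some depth on.\<close>
    have "{\<omega> \<in> space ?M. \<not> has_infinite_cluster V E \<omega>} \<subseteq> (\<Union>i. ?G i)"
    proof
      fix \<omega> assume \<omega>: "\<omega> \<in> {\<omega> \<in> space ?M. \<not> has_infinite_cluster V E \<omega>}"
      then have "finite (\<Union>y\<in>level x0 k. {j. hits (j * n) y \<omega>})"
        using finite_level[OF x0(1)] level_in_V[of x0 k] n
        by (auto simp: has_infinite_cluster_iff intro!: finitely_many_hits)
      then obtain i where "\<And>j. j \<in> (\<Union>y\<in>level x0 k. {j. hits (j * n) y \<omega>}) \<Longrightarrow> j < i"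
        by (auto simp: finite_nat_set_iff_bounded)
      then have "\<omega> \<in> ?G i" using \<omega> by fastforce
      then show "\<omega> \<in> (\<Union>i. ?G i)" by blast
    qed
    then have "\<P>(\<omega> in ?M. \<not> has_infinite_cluster V E \<omega>) \<le> measure ?M (\<Union>i. ?G i)"
      using mG by (intro finite_measure_mono) auto
    also have "\<dots> \<le> (1 - \<delta>) ^ k"
    proof (rule LIMSEQ_le_const2)
      show "(\<lambda>i. measure ?M (?G i)) \<longlonglongrightarrow> measure ?M (\<Union>i. ?G i)"
        using mG by (intro finite_Lim_measure_incseq) (auto simp: incseq_def)
    qed (use Gle in blast)
    finally show ?thesis .
  qed
  have "\<P>(\<omega> in ?M. \<not> has_infinite_cluster V E \<omega>) \<le> 0"
  proof (rule LIMSEQ_le_const)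
    show "(\<lambda>k. (1 - \<delta>) ^ k) \<longlonglongrightarrow> 0" using \<delta> by (intro LIMSEQ_realpow_zero) auto
  qed (use bound in blast)
  moreover have "\<P>(\<omega> in ?M. \<not> has_infinite_cluster V E \<omega>) = 1 - \<P>(\<omega> in ?M. has_infinite_cluster V E \<omega>)"
    by (intro prob_neg measurable_has_infinite_cluster)
  ultimately show ?thesis using prob_le_1[of "{\<omega> \<in> space ?M. has_infinite_cluster V E \<omega>}"] by linarith
qed

section \<open>An infinite cluster implies mean larger than one\<close>

text \<open>The edges that leave the set of descendants of \<open>x\<close>.\<close>

definition bdry :: "'a \<Rightarrow> 'a set set" where
  "bdry x = {e\<in>E. e \<inter> desc x \<noteq> {} \<and> \<not> e \<subseteq> desc x}"

lemma descI: "y \<in> V \<Longrightarrow> (par ^^ n) y = x \<Longrightarrow> y \<in> desc x"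
  by (auto simp: desc_def level_def)

lemma bdry_sub: "bdry x \<subseteq> E"
  by (auto simp: bdry_def)

text \<open>
  For an edge \<open>{u, v}\<close> leaving the descendants of \<open>x\<close> from \<open>u\<close>, the common ancestor given by
  \<open>edge_range\<close> lies strictly above \<open>x\<close>, since otherwise \<open>v\<close> would be a descendant of \<open>x\<close> too.
\<close>

lemma bdry_cases:
  assumes "edge_range R" "x \<in> V" "e \<in> bdry x"
  obtains u v i j where "e = {u, v}" "u \<in> V" "v \<in> V" "u \<in> block x R" "i < R" "j < R"
    "(par ^^ i) x = (par ^^ j) v"
proof -
  obtain u v where e: "e = {u, v}" "e \<in> E" "u \<in> desc x" "v \<notin> desc x"
  proof -
    have "e \<in> E" "e \<in> unordered_pairs V" using assms(3) E_pairs by (auto simp: bdry_def)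
    then obtain a b where ab: "e = {a, b}" "e \<in> E" by (auto simp: unordered_pairs_def)
    consider "a \<in> desc x" "b \<notin> desc x" | "b \<in> desc x" "a \<notin> desc x"
      using ab assms(3) by (auto simp: bdry_def)
    then show ?thesis using ab that[of a b] that[of b a] by (cases; auto simp: insert_commute)
  qed
  have V: "u \<in> V" "v \<in> V" using e edge_in_V by auto
  obtain i j where ij: "i < R" "j < R" "(par ^^ i) u = (par ^^ j) v"
    using assms(1) e unfolding edge_range_def by blast
  obtain a where a: "u \<in> level x a" using e by (auto simp: desc_def)
  then have ua: "(par ^^ a) u = x" by (simp add: level_def)
  have "a < i"
  proof (rule ccontr)
    assume "\<not> a < i"
    then have "(par ^^ (a - i)) ((par ^^ i) u) = x" using ua unfolding funpow_plus by simp
    then have "(par ^^ (a - i + j)) v = x" unfolding ij(3) funpow_plus .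
    then show False using e V by (auto intro: descI)
  qed
  then have "(par ^^ (i - a)) x = (par ^^ i) u"
    unfolding ua[symmetric] funpow_plus by simp
  moreover have "u \<in> block x R" using a ij(1) \<open>a < i\<close> by (auto simp: block_def)
  ultimately show ?thesis using that[of u v "i - a" j] e V ij by auto
qed

lemma finite_bdry:
  assumes x: "x \<in> V" shows "finite (bdry x)"
proof -
  obtain R where R: "edge_range R" using edges_short by blast
  have "bdry x \<subseteq> (\<Union>u\<in>block x R. (\<lambda>v. {u, v}) ` neighbours V E u)"
  proof
    fix e assume e: "e \<in> bdry x"
    then obtain u v where "e = {u, v}" "u \<in> V" "v \<in> V" "u \<in> block x R"
      using bdry_cases[OF R x] by metis
    then show "e \<in> (\<Union>u\<in>block x R. (\<lambda>v. {u, v}) ` neighbours V E u)"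
      using e by (auto simp: neighbours_def bdry_def)
  qed
  moreover have "finite (\<Union>u\<in>block x R. (\<lambda>v. {u, v}) ` neighbours V E u)"
    using finite_block[OF x] block_in_V finite_nbrs by blast
  ultimately show ?thesis by (rule finite_subset)
qed

lemma bdry_inner:
  assumes "edge_range R" "x \<in> V" "e \<in> bdry x" "R \<le> m"
  shows "e \<subseteq> desc ((par ^^ m) x)"
proof -
  obtain u v i j where *: "e = {u, v}" "u \<in> V" "v \<in> V" "u \<in> block x R" "i < R" "j < R"
    "(par ^^ i) x = (par ^^ j) v" using bdry_cases[OF assms(1-3)] by metis
  have "(par ^^ m) x = (par ^^ (m - i)) ((par ^^ i) x)"
    using *(5) assms(4) unfolding funpow_plus by simp
  then have "(par ^^ (m - i + j)) v = (par ^^ m) x" unfolding *(7) funpow_plus by simp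
  moreover obtain a where "(par ^^ a) u = x" using *(4) by (auto simp: block_def level_def)
  then have "(par ^^ (m + a)) u = (par ^^ m) x" by (simp add: funpow_add)
  ultimately show ?thesis using * by (auto intro: descI)
qed

lemma bdry_disjoint:
  assumes "edge_range R" "x \<in> V" "n + R \<le> m"
  shows "bdry ((par ^^ n) x) \<inter> bdry ((par ^^ m) x) = {}"
proof -
  have "(par ^^ (m - n)) ((par ^^ n) x) = (par ^^ m) x"
    using assms(3) unfolding funpow_plus by simp
  then have "e \<subseteq> desc ((par ^^ m) x)" if "e \<in> bdry ((par ^^ n) x)" for e
    using bdry_inner[OF assms(1) funpow_par_in[OF assms(2)] that, of "m - n"] assms(3) by simp
  then show ?thesis by (auto simp: bdry_def)
qed

lemma card_bdry:
  assumes x: "x \<in> V" and y: "y \<in> V"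
  shows "card (bdry y) = card (bdry x)"
proof -
  obtain \<alpha> where \<alpha>: "\<alpha> \<in> L" "\<alpha> x = y" using L_trans[OF x y] by blast
  have inj: "inj_on \<alpha> V" and E: "(`) \<alpha> ` E = E" and injE: "inj_on ((`) \<alpha>) E"
    using L_bij[OF \<alpha>(1)] bij_edges[OF \<alpha>(1)] by (auto simp: bij_betw_def)
  have D: "desc y = \<alpha> ` desc x" using desc_image[OF \<alpha>(1) x] \<alpha> by simp
  have iff: "\<alpha> ` e \<in> bdry y \<longleftrightarrow> e \<in> bdry x" if e: "e \<in> E" for e
  proof -
    have eV: "e \<subseteq> V" by (rule edge_in_V[OF e])
    have "\<alpha> ` e \<inter> desc y = \<alpha> ` (e \<inter> desc x)"
      unfolding D using inj_on_image_Int[OF inj eV desc_in_V] by simp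
    moreover have "\<alpha> ` e \<subseteq> desc y \<longleftrightarrow> e \<subseteq> desc x"
      unfolding D using inj_on_image_subset_iff[OF inj eV desc_in_V] .
    moreover have "\<alpha> ` e \<in> E" using E e by blast
    ultimately show ?thesis using e by (simp add: bdry_def)
  qed
  have "bdry y = (`) \<alpha> ` bdry x"
  proof (intro equalityI subsetI)
    fix f assume f: "f \<in> bdry y"
    then have "f \<in> (`) \<alpha> ` E" using E bdry_sub by auto
    then show "f \<in> (`) \<alpha> ` bdry x" using f iff by auto
  next
    fix f assume "f \<in> (`) \<alpha> ` bdry x"
    then show "f \<in> bdry y" using iff subsetD[OF bdry_sub] by auto
  qed
  moreover have "inj_on ((`) \<alpha>) (bdry x)" using injE bdry_sub by (rule inj_on_subset)
  ultimately show ?thesis by (simp add: card_image)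
qed

lemma reach_confined_by_cut:
  assumes "\<forall>e\<in>bdry x. \<not> \<omega> e" "y \<in> desc x" "reach E \<omega> y z"
  shows "reach (edges_in (desc x)) \<omega> y z"
proof -
  have "z \<in> desc x \<and> reach (edges_in (desc x)) \<omega> y z" using assms(3)
  proof (induction rule: reach_induct)
    case base
    then show ?case using assms by simp
  next
    case (step z w)
    then have "{z, w} \<subseteq> desc x" using assms(1) by (auto simp: bdry_def)
    moreover from this have "reach (edges_in (desc x)) \<omega> z w"
      using step by (intro reach_edge) (auto simp: edges_in_def)
    ultimately show ?case using step by (auto intro: reach_trans)
  qed
  then show ?thesis ..
qed

text \<open>
  If all edges leaving the descendants of some ancestor of \<open>x\<close> are closed, the cluster of \<open>x\<close> stays
  below that ancestor. The cuts at every \<open>R\<close>-th ancestor are disjoint and of equal size, so, as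
  \<open>p < 1\<close>, almost surely one of them is closed.
\<close>

lemma infinite_below:
  assumes p: "0 \<le> p" "p < 1" and x: "x \<in> V"
    and pos: "\<P>(\<omega> in percolation E p. infinite {y. reach E \<omega> x y}) > 0"
  shows "\<exists>n. \<P>(\<omega> in percolation E p. infinite {y. reach (edges_in (desc ((par ^^ n) x))) \<omega> x y}) > 0"
proof (rule ccontr)
  let ?M = "percolation E p"
  let ?I = "\<lambda>n \<omega>. infinite {y. reach (edges_in (desc ((par ^^ n) x))) \<omega> x y}"
  let ?Cut = "\<lambda>n \<omega>. \<forall>e\<in>bdry ((par ^^ n) x). \<not> \<omega> e"
  interpret prob_space ?M by (rule prob_space_percolation)
  obtain R where R: "edge_range R" using edges_short by blast
  assume "\<not> (\<exists>n. \<P>(\<omega> in ?M. ?I n \<omega>) > 0)"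
  then have "\<P>(\<omega> in ?M. ?I n \<omega>) = 0" for n by (simp add: not_less measure_le_0_iff)
  then have "AE \<omega> in ?M. \<not> ?I n \<omega>" for n
    using measurable_infinite_cluster[OF edges_in_sub x] by (subst (asm) prob_Collect_eq_0) auto
  then have AE: "AE \<omega> in ?M. \<forall>n. \<not> ?I n \<omega>" by (simp add: AE_all_countable)
  define c where "c = (1 - p) ^ card (bdry x)"
  have c: "0 < c" "c \<le> 1" using p by (auto simp: c_def power_le_one)
  have fb: "finite (bdry ((par ^^ n) x))" for n by (intro finite_bdry funpow_par_in x)
  have dep: "depends_on (bdry ((par ^^ n) x)) (?Cut n)" for n by (rule depends_onI) auto
  have bound: "\<P>(\<omega> in ?M. infinite {y. reach E \<omega> x y}) \<le> (1 - c) ^ k" for k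
  proof -
    have mC: "{\<omega> \<in> space ?M. \<forall>j\<in>{..<k}. \<not> ?Cut (j * R) \<omega>} \<in> sets ?M"
      by (intro sets.sets_Collect_countable_All' sets.sets_Collect_neg[OF measurable_depends_on[OF fb bdry_sub dep]]) auto
    have "\<P>(\<omega> in ?M. infinite {y. reach E \<omega> x y}) \<le> \<P>(\<omega> in ?M. \<forall>j\<in>{..<k}. \<not> ?Cut (j * R) \<omega>)"
    proof (rule finite_measure_mono_AE)
      show "AE \<omega> in ?M. \<omega> \<in> {\<omega> \<in> space ?M. infinite {y. reach E \<omega> x y}} \<longrightarrow>
          \<omega> \<in> {\<omega> \<in> space ?M. \<forall>j\<in>{..<k}. \<not> ?Cut (j * R) \<omega>}"
        using AE
      proof eventually_elim
        case (elim \<omega>)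
        show ?case
        proof (intro impI CollectI conjI ballI notI)
          fix j assume \<omega>: "\<omega> \<in> {\<omega> \<in> space ?M. infinite {y. reach E \<omega> x y}}" and cut: "?Cut (j * R) \<omega>"
          have "x \<in> desc ((par ^^ (j * R)) x)" using x by (intro descI) auto
          then have "{y. reach E \<omega> x y} \<subseteq> {y. reach (edges_in (desc ((par ^^ (j * R)) x))) \<omega> x y}"
            using reach_confined_by_cut[OF cut] by blast
          then have "?I (j * R) \<omega>" using \<omega> infinite_super by blast
          then show False using elim by blast
        qed auto
      qed
    qed (rule mC)
    also have "\<dots> = (\<Prod>j\<in>{..<k}. \<P>(\<omega> in ?M. \<not> ?Cut (j * R) \<omega>))"
    proof (rule prob_indep_family[where F = "\<lambda>j. bdry ((par ^^ (j * R)) x)"])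
      have "bdry ((par ^^ (i * R)) x) \<inter> bdry ((par ^^ (j * R)) x) = {}" if "i < j" for i j
      proof (rule bdry_disjoint[OF R x])
        have "Suc i * R \<le> j * R" using that by (intro mult_le_mono1) auto
        then show "i * R + R \<le> j * R" by simp
      qed
      then show "disjoint_family_on (\<lambda>j. bdry ((par ^^ (j * R)) x)) {..<k}"
        unfolding disjoint_family_on_def by (metis Int_commute linorder_neqE_nat)
    qed (rule finite_lessThan fb bdry_sub depends_on_not[OF dep] p(1) less_imp_le[OF p(2)])+
    also have "\<dots> = (\<Prod>j\<in>{..<k}. 1 - c)"
    proof (intro prod.cong refl)
      fix j
      have "\<P>(\<omega> in ?M. \<not> ?Cut (j * R) \<omega>) = 1 - \<P>(\<omega> in ?M. ?Cut (j * R) \<omega>)"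
        by (rule prob_neg) (rule measurable_depends_on[OF fb bdry_sub dep])
      also have "\<P>(\<omega> in ?M. ?Cut (j * R) \<omega>) = c"
        using prob_all_closed[OF fb bdry_sub, of p "j * R"] p card_bdry[OF x funpow_par_in[OF x], of "j * R"]
        by (simp add: c_def)
      finally show "\<P>(\<omega> in ?M. \<not> ?Cut (j * R) \<omega>) = 1 - c" .
    qed
    finally show ?thesis by simp
  qed
  have "\<P>(\<omega> in ?M. infinite {y. reach E \<omega> x y}) \<le> 0"
  proof (rule LIMSEQ_le_const)
    show "(\<lambda>k. (1 - c) ^ k) \<longlonglongrightarrow> 0" using c by (intro LIMSEQ_realpow_zero) auto
  qed (use bound in blast)
  then show False using pos by simp
qed

text \<open>
  The window is made of the last \<open>R\<close> levels of \<open>block x n\<close>. If \<open>edge_range R\<close> holds, an edge leaving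
  the block downwards starts there; the front is the part of it that \<open>v\<close> reaches inside the block. \<open>out_edges x n U\<close> are the
  edges from \<open>U\<close> to descendants of \<open>x\<close> deeper than \<open>n\<close>, provided that \<open>U \<subseteq> block x n\<close>.
\<close>

definition window :: "nat \<Rightarrow> 'a \<Rightarrow> nat \<Rightarrow> 'a set" where
  "window R x n = (\<Union>k\<in>{k. k \<le> n \<and> n < k + R}. level x k)"

definition front :: "nat \<Rightarrow> 'a \<Rightarrow> 'a \<Rightarrow> nat \<Rightarrow> ('a set \<Rightarrow> bool) \<Rightarrow> 'a set" where
  "front R x v n \<omega> = {w\<in>window R x n. reach (edges_in (block x n)) \<omega> v w}"

definition out_edges :: "'a \<Rightarrow> nat \<Rightarrow> 'a set \<Rightarrow> 'a set set" where
  "out_edges x n U = {e\<in>edges_in (desc x). e \<inter> U \<noteq> {} \<and> \<not> e \<subseteq> block x n}"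

lemma window_sub_block: "window R x n \<subseteq> block x n"
  by (auto simp: window_def block_def)

lemma finite_window: "x \<in> V \<Longrightarrow> finite (window R x n)"
  using window_sub_block finite_block by (rule finite_subset)

lemma window_sub_V: "window R x n \<subseteq> V"
  using window_sub_block block_in_V by blast

lemma reach_confined_by_front:
  assumes R: "edge_range R" and v: "v \<in> block x n"
    and closed: "\<forall>e\<in>out_edges x n (front R x v n \<omega>). \<not> \<omega> e"
    and reach: "reach (edges_in (desc x)) \<omega> v y"
  shows "y \<in> block x n"
proof -
  have "y \<in> block x n \<and> reach (edges_in (block x n)) \<omega> v y" using reach
  proof (induction rule: reach_induct)
    case base
    then show ?case using v by simp
  next
    case (step y z)
    have z: "z \<in> block x n"
    proof (rule ccontr)
      assume nz: "z \<notin> block x n"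
      have yz: "{y, z} \<in> E" "y \<in> V" "z \<in> V" "z \<in> desc x"
        using step edge_in_V by (auto simp: edges_in_def)
      obtain a where a: "a \<le> n" "y \<in> level x a" using step by (auto simp: block_def)
      obtain b where b: "z \<in> level x b" using yz by (auto simp: desc_def)
      have "n < b" using nz b by (force simp: block_def)
      obtain i j where ij: "i < R" "j < R" "(par ^^ i) y = (par ^^ j) z"
        using R yz unfolding edge_range_def by blast
      \<comment> \<open>Both climbs from \<open>z\<close> end at the \<open>i\<close>-th ancestor of \<open>x\<close>, so they have the same length.\<close>
      have "(par ^^ (a + j)) z = (par ^^ a) ((par ^^ i) y)" by (simp add: funpow_add ij(3))
      also have "\<dots> = (par ^^ i) ((par ^^ a) y)" by (metis add.commute comp_apply funpow_add)
      also have "\<dots> = (par ^^ (i + b)) z" using a b by (simp add: funpow_add level_def)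
      finally have "a + j = i + b" by (rule par_inj[OF yz(3)])
      then have "y \<in> window R x n" using a ij \<open>n < b\<close> by (auto simp: window_def)
      then have "y \<in> front R x v n \<omega>" using step by (auto simp: front_def)
      then have "{y, z} \<in> out_edges x n (front R x v n \<omega>)" using step nz by (auto simp: out_edges_def)
      then show False using closed step by blast
    qed
    then have "reach (edges_in (block x n)) \<omega> y z"
      using step by (intro reach_edge) (auto simp: edges_in_def)
    then show ?case using step z by (auto intro: reach_trans)
  qed
  then show ?thesis ..
qed

lemma degree_bound:
  obtains D where "\<And>u. u \<in> V \<Longrightarrow> card (neighbours V E u) \<le> D"
proof -
  obtain x where x: "x \<in> V" using V_ne by auto
  have "card (neighbours V E u) \<le> card (neighbours V E x)" if u: "u \<in> V" for u
  proof -
    obtain \<alpha> where \<alpha>: "\<alpha> \<in> L" "\<alpha> x = u" using L_trans[OF x u] by blast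
    have "neighbours V E u \<subseteq> \<alpha> ` neighbours V E x"
    proof
      fix v assume v: "v \<in> neighbours V E u"
      then obtain w where w: "w \<in> V" "v = \<alpha> w"
        using bij_betw_imp_surj_on[OF L_bij[OF \<alpha>(1)]] by (auto simp: neighbours_def)
      then have "{x, w} \<in> E" using L_edge[OF \<alpha>(1), of "{x, w}"] v \<alpha> x by (auto simp: neighbours_def)
      then show "v \<in> \<alpha> ` neighbours V E x" using w by (auto simp: neighbours_def)
    qed
    then show ?thesis by (meson card_image_le card_mono finite_imageI finite_nbrs le_trans x)
  qed
  then show ?thesis using that by blast
qed

lemma card_out_edges:
  assumes D: "\<And>u. u \<in> V \<Longrightarrow> card (neighbours V E u) \<le> D" and U: "finite U" "U \<subseteq> V"
  shows "finite (out_edges x n U)" "card (out_edges x n U) \<le> card U * D"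
proof -
  let ?S = "\<Union>u\<in>U. (\<lambda>v. {u, v}) ` neighbours V E u"
  have sub: "out_edges x n U \<subseteq> ?S"
  proof
    fix e assume e: "e \<in> out_edges x n U"
    then obtain u where u: "u \<in> e" "u \<in> U" by (auto simp: out_edges_def)
    have eE: "e \<in> E" using e by (auto simp: out_edges_def edges_in_def)
    then obtain v where "e = {u, v}" "v \<in> V" using u E_pairs by (auto simp: unordered_pairs_def)
    then show "e \<in> ?S" using u eE by (auto simp: neighbours_def)
  qed
  have fS: "finite ?S" using U finite_nbrs by auto
  show "finite (out_edges x n U)" using sub fS by (rule finite_subset)
  have "card (out_edges x n U) \<le> card ?S" by (rule card_mono[OF fS sub])
  also have "\<dots> \<le> (\<Sum>u\<in>U. card ((\<lambda>v. {u, v}) ` neighbours V E u))" by (rule card_UN_le[OF U(1)])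
  also have "\<dots> \<le> (\<Sum>u\<in>U. D)"
  proof (rule sum_mono)
    fix u assume "u \<in> U"
    then have "u \<in> V" using U by auto
    then show "card ((\<lambda>v. {u, v}) ` neighbours V E u) \<le> D"
      using card_image_le[OF finite_nbrs] D by (meson le_trans)
  qed
  finally show "card (out_edges x n U) \<le> card U * D" by simp
qed

lemma depends_on_front: "depends_on (edges_in (block x n)) (\<lambda>\<omega>. front R x v n \<omega> = U)"
  unfolding front_def by (intro depends_on_Collect_eq depends_on_reach)

lemma depends_on_front': "depends_on (edges_in (block x n)) (\<lambda>\<omega>. P (front R x v n \<omega>))"
proof (rule depends_onI)
  fix \<omega> \<omega>' assume "\<And>e. e \<in> edges_in (block x n) \<Longrightarrow> \<omega> e = \<omega>' e" "P (front R x v n \<omega>)"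
  then show "P (front R x v n \<omega>')"
    using depends_onD[OF depends_on_front, of x n \<omega> \<omega>' R v "front R x v n \<omega>"] by simp
qed

lemma measurable_front:
  "x \<in> V \<Longrightarrow> {\<omega> \<in> space (percolation E p). P (front R x v n \<omega>)} \<in> sets (percolation E p)"
  using measurable_depends_on[OF finite_edges_block edges_in_sub depends_on_front'] .

lemma prob_front_partition:
  assumes "x \<in> V" "{\<omega> \<in> space (percolation E p). Q \<omega>} \<in> sets (percolation E p)"
  shows "\<P>(\<omega> in percolation E p. Q \<omega>) =
    (\<Sum>U\<in>Pow (window R x n). \<P>(\<omega> in percolation E p. front R x v n \<omega> = U \<and> Q \<omega>))"
  unfolding front_def
  by (rule prob_partition[OF finite_window[OF assms(1)] finite_edges_block[OF assms(1)] edges_in_sub depends_on_reach assms(2)])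

text \<open>The front at depth \<open>n\<close> is nonempty, has at most \<open>N\<close> vertices, and no open edge leads from it further down.\<close>

definition dies :: "nat \<Rightarrow> 'a \<Rightarrow> 'a \<Rightarrow> nat \<Rightarrow> nat \<Rightarrow> ('a set \<Rightarrow> bool) \<Rightarrow> bool" where
  "dies R x v N n \<omega> \<longleftrightarrow> front R x v n \<omega> \<noteq> {} \<and> card (front R x v n \<omega>) \<le> N \<and>
     (\<forall>e\<in>out_edges x n (front R x v n \<omega>). \<not> \<omega> e)"

lemma measurable_dies:
  assumes x: "x \<in> V"
  shows "{\<omega> \<in> space (percolation E p). dies R x v N n \<omega>} \<in> sets (percolation E p)"
proof -
  obtain D where D: "\<And>u. u \<in> V \<Longrightarrow> card (neighbours V E u) \<le> D" using degree_bound by blast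
  have "dies R x v N n \<omega> \<longleftrightarrow> (\<exists>U\<in>Pow (window R x n). front R x v n \<omega> = U \<and> U \<noteq> {} \<and> card U \<le> N \<and>
      (\<forall>e\<in>out_edges x n U. \<not> \<omega> e))" for \<omega>
    unfolding dies_def by (auto simp: front_def)
  moreover have "{\<omega> \<in> space (percolation E p). \<forall>e\<in>out_edges x n U. \<not> \<omega> e} \<in> sets (percolation E p)"
    if "U \<in> Pow (window R x n)" for U
  proof (rule measurable_depends_on)
    show "finite (out_edges x n U)"
      using that finite_window[OF x] window_sub_V[of R x n]
      by (intro card_out_edges[OF D]) (auto intro: finite_subset)
    show "out_edges x n U \<subseteq> E" by (auto simp: out_edges_def edges_in_def)
  qed (rule depends_onI, auto)
  ultimately show ?thesis
    using finite_window[OF x] x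
    by (simp only:, intro sets.sets_Collect_finite_Ex sets.sets_Collect_conj measurable_front sets.sets_Collect_const)
       auto
qed

text \<open>
  Given the front, which is determined by the edges inside the block, the at most \<open>N * D\<close> edges
  leading further down are still independent of it.
\<close>

lemma prob_dies_ge:
  assumes p: "0 \<le> p" "p \<le> 1" and x: "x \<in> V"
    and D: "\<And>u. u \<in> V \<Longrightarrow> card (neighbours V E u) \<le> D"
  shows "(1 - p) ^ (N * D) * \<P>(\<omega> in percolation E p. front R x v n \<omega> \<noteq> {} \<and> card (front R x v n \<omega>) \<le> N)
    \<le> \<P>(\<omega> in percolation E p. dies R x v N n \<omega>)"
proof -
  let ?M = "percolation E p" and ?F = "front R x v n"
  interpret prob_space ?M by (rule prob_space_percolation)
  let ?small = "\<lambda>\<omega>. ?F \<omega> \<noteq> {} \<and> card (?F \<omega>) \<le> N"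
  have "(1 - p) ^ (N * D) * \<P>(\<omega> in ?M. ?small \<omega>) =
     (\<Sum>U\<in>Pow (window R x n). (1 - p) ^ (N * D) * \<P>(\<omega> in ?M. ?F \<omega> = U \<and> ?small \<omega>))"
    unfolding sum_distrib_left[symmetric]
    by (rule arg_cong2[OF refl prob_front_partition[OF x measurable_front[OF x, where P = "\<lambda>U. U \<noteq> {} \<and> card U \<le> N"]]])
  also have "\<dots> \<le> (\<Sum>U\<in>Pow (window R x n). \<P>(\<omega> in ?M. ?F \<omega> = U \<and> dies R x v N n \<omega>))"
  proof (rule sum_mono)
    fix U assume U: "U \<in> Pow (window R x n)"
    show "(1 - p) ^ (N * D) * \<P>(\<omega> in ?M. ?F \<omega> = U \<and> ?small \<omega>) \<le> \<P>(\<omega> in ?M. ?F \<omega> = U \<and> dies R x v N n \<omega>)"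
    proof (cases "U \<noteq> {} \<and> card U \<le> N")
      case False
      then have "{\<omega> \<in> space ?M. ?F \<omega> = U \<and> ?small \<omega>} = {}" by auto
      then show ?thesis by (simp only: measure_empty) simp
    next
      case True
      let ?O = "out_edges x n U"
      have O: "finite ?O" "card ?O \<le> card U * D"
        using U finite_window[OF x] window_sub_V[of R x n]
        by (intro card_out_edges[OF D]; auto intro: finite_subset)+
      have OE: "?O \<subseteq> E" by (auto simp: out_edges_def edges_in_def)
      have "edges_in (block x n) \<inter> ?O = {}" by (auto simp: edges_in_def out_edges_def)
      moreover have dO: "depends_on ?O (\<lambda>\<omega>. \<forall>e\<in>?O. \<not> \<omega> e)" by (rule depends_onI) auto
      ultimately have ind: "\<P>(\<omega> in ?M. ?F \<omega> = U \<and> (\<forall>e\<in>?O. \<not> \<omega> e)) = \<P>(\<omega> in ?M. ?F \<omega> = U) * (1 - p) ^ card ?O"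
        using prob_indep[OF finite_edges_block[OF x] edges_in_sub depends_on_front O(1) OE dO _ p]
          prob_all_closed[OF O(1) OE p] by simp
      have "card ?O \<le> N * D" using O(2) True mult_le_mono1[of "card U" N D] by linarith
      then have "(1 - p) ^ (N * D) \<le> (1 - p) ^ card ?O" using p by (intro power_decreasing) auto
      then have "(1 - p) ^ (N * D) * \<P>(\<omega> in ?M. ?F \<omega> = U) \<le> \<P>(\<omega> in ?M. ?F \<omega> = U \<and> (\<forall>e\<in>?O. \<not> \<omega> e))"
        unfolding ind by (subst mult.commute) (intro mult_left_mono; simp)
      moreover have "{\<omega> \<in> space ?M. ?F \<omega> = U \<and> ?small \<omega>} = {\<omega> \<in> space ?M. ?F \<omega> = U}" using True by auto
      moreover have "{\<omega> \<in> space ?M. ?F \<omega> = U \<and> dies R x v N n \<omega>} = {\<omega> \<in> space ?M. ?F \<omega> = U \<and> (\<forall>e\<in>?O. \<not> \<omega> e)}"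
        using True by (auto simp: dies_def)
      ultimately show ?thesis by simp
    qed
  qed
  also have "\<dots> = \<P>(\<omega> in ?M. dies R x v N n \<omega>)"
    by (rule prob_front_partition[OF x measurable_dies[OF x], symmetric])
  finally show ?thesis .
qed

lemma dies_disjoint:
  assumes R: "edge_range R" and v: "v \<in> block x n" and nm: "n + R \<le> m" and dies: "dies R x v N n \<omega>"
  shows "\<not> dies R x v N m \<omega>"
proof
  assume "dies R x v N m \<omega>"
  then obtain w k where w: "w \<in> level x k" "m < k + R" "reach (edges_in (block x m)) \<omega> v w"
    by (auto simp: dies_def front_def window_def)
  have "reach (edges_in (desc x)) \<omega> v w"
    using w(3) by (rule reach_mono) (simp_all add: edges_in_mono block_desc)
  then have "w \<in> block x n" using dies by (intro reach_confined_by_front[OF R v]) (auto simp: dies_def)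
  then obtain l where "l \<le> n" "w \<in> level x l" by (auto simp: block_def)
  then have "k \<le> n" using level_unique[OF w(1)] by auto
  then show False using w nm by simp
qed

text \<open>
  The events \<open>dies\<close> at the depths \<open>t + j * R\<close> are disjoint, so their probabilities sum to at most 1.
  If the front were small with probability at least \<open>\<epsilon>\<close> at all depths \<open>n \<ge> t\<close>, they would be bounded
  below by a positive constant.
\<close>

lemma front_not_small:
  assumes p: "0 \<le> p" "p < 1" and R: "edge_range R" and x: "x \<in> V" and v: "v \<in> level x t" and \<epsilon>: "0 < \<epsilon>"
  shows "\<exists>n\<ge>t. \<P>(\<omega> in percolation E p. front R x v n \<omega> \<noteq> {} \<and> card (front R x v n \<omega>) \<le> N) < \<epsilon>"
proof (rule ccontr)
  let ?M = "percolation E p"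
  interpret prob_space ?M by (rule prob_space_percolation)
  assume "\<not> ?thesis"
  then have big: "\<epsilon> \<le> \<P>(\<omega> in ?M. front R x v n \<omega> \<noteq> {} \<and> card (front R x v n \<omega>) \<le> N)" if "t \<le> n" for n
    using that by (auto simp: not_less)
  obtain D where D: "\<And>u. u \<in> V \<Longrightarrow> card (neighbours V E u) \<le> D" using degree_bound by blast
  define c where "c = (1 - p) ^ (N * D) * \<epsilon>"
  have c: "0 < c" using p \<epsilon> by (simp add: c_def)
  let ?A = "\<lambda>j. {\<omega> \<in> space ?M. dies R x v N (t + j * R) \<omega>}"
  have "c \<le> measure ?M (?A j)" for j
  proof -
    have "c \<le> (1 - p) ^ (N * D) * \<P>(\<omega> in ?M. front R x v (t + j * R) \<omega> \<noteq> {} \<and> card (front R x v (t + j * R) \<omega>) \<le> N)"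
      unfolding c_def using p by (intro mult_left_mono big) auto
    also have "\<dots> \<le> measure ?M (?A j)" using p by (intro prob_dies_ge x D) auto
    finally show ?thesis .
  qed
  then have le: "real J * c \<le> 1" for J
  proof -
    assume *: "\<And>j. c \<le> measure ?M (?A j)"
    have disj: "?A i \<inter> ?A j = {}" if "i < j" for i j
    proof -
      have "Suc i * R \<le> j * R" using that by (intro mult_le_mono1) auto
      moreover have "v \<in> block x (t + i * R)" using v level_block[of t "t + i * R" x] by auto
      ultimately have "\<not> dies R x v N (t + j * R) \<omega>" if "dies R x v N (t + i * R) \<omega>" for \<omega>
        using dies_disjoint[OF R _ _ that, of "t + j * R"] by simp
      then show ?thesis by blast
    qed
    have "real J * c = (\<Sum>j<J. c)" by simp
    also have "\<dots> \<le> (\<Sum>j<J. measure ?M (?A j))" by (intro sum_mono *)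
    also have "\<dots> = measure ?M (\<Union>j<J. ?A j)"
    proof (rule finite_measure_finite_Union[symmetric])
      show "disjoint_family_on ?A {..<J}"
        unfolding disjoint_family_on_def
      proof (intro ballI impI)
        fix i j :: nat assume "i \<noteq> j"
        then have "i < j \<or> j < i" by auto
        then show "?A i \<inter> ?A j = {}" using disj[of i j] disj[of j i] by blast
      qed
    qed (use measurable_dies[OF x] in auto)
    also have "\<dots> \<le> 1" by (rule prob_le_1)
    finally show ?thesis .
  qed
  obtain J :: nat where "1 / c < J" using reals_Archimedean2 by blast
  then have "1 < real J * c" using c by (simp add: pos_divide_less_eq)
  then show False using le[of J] by simp
qed

text \<open>
  On an infinite cluster the front is never empty; at a depth where it is rarely small, it therefore
  has more than \<open>N\<close> vertices with probability at least \<open>q / 2\<close>.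
\<close>

lemma expected_front_large:
  assumes p: "0 \<le> p" "p < 1" and R: "edge_range R" and x: "x \<in> V" and v: "v \<in> level x t"
    and q: "q = \<P>(\<omega> in percolation E p. infinite {y. reach (edges_in (desc x)) \<omega> v y})" "0 < q"
  shows "\<exists>n\<ge>t. real N * (q / 2) \<le>
    (\<Sum>w\<in>window R x n. \<P>(\<omega> in percolation E p. reach (edges_in (block x n)) \<omega> v w))"
proof -
  let ?M = "percolation E p"
  interpret prob_space ?M by (rule prob_space_percolation)
  obtain n where n: "t \<le> n" and small: "\<P>(\<omega> in ?M. front R x v n \<omega> \<noteq> {} \<and> card (front R x v n \<omega>) \<le> N) < q / 2"
    using front_not_small[OF p R x v, of "q / 2" N] q by auto
  let ?F = "front R x v n"
  have vb: "v \<in> block x n" using v n level_block by blast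
  have vV: "v \<in> V" using v level_in_V by auto
  have "q \<le> measure ?M ({\<omega> \<in> space ?M. ?F \<omega> \<noteq> {} \<and> card (?F \<omega>) \<le> N} \<union> {\<omega> \<in> space ?M. N < card (?F \<omega>)})"
    unfolding q(1)
  proof (rule finite_measure_mono)
    have "?F \<omega> \<noteq> {}" if "infinite {y. reach (edges_in (desc x)) \<omega> v y}" for \<omega>
    proof
      assume "?F \<omega> = {}"
      then have "{y. reach (edges_in (desc x)) \<omega> v y} \<subseteq> block x n"
        using reach_confined_by_front[OF R vb, of \<omega>] by (auto simp: out_edges_def)
      then show False using that finite_block[OF x] finite_subset by blast
    qed
    then show "{\<omega> \<in> space ?M. infinite {y. reach (edges_in (desc x)) \<omega> v y}}
      \<subseteq> {\<omega> \<in> space ?M. ?F \<omega> \<noteq> {} \<and> card (?F \<omega>) \<le> N} \<union> {\<omega> \<in> space ?M. N < card (?F \<omega>)}"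
      by (auto simp: not_le)
    show "{\<omega> \<in> space ?M. ?F \<omega> \<noteq> {} \<and> card (?F \<omega>) \<le> N} \<union> {\<omega> \<in> space ?M. N < card (?F \<omega>)} \<in> sets ?M"
      by (intro sets.Un measurable_front[OF x, of p "\<lambda>U. U \<noteq> {} \<and> card U \<le> N"] measurable_front[OF x, of p "\<lambda>U. N < card U"])
  qed
  also have "\<dots> \<le> \<P>(\<omega> in ?M. ?F \<omega> \<noteq> {} \<and> card (?F \<omega>) \<le> N) + \<P>(\<omega> in ?M. N < card (?F \<omega>))"
    by (intro measure_Un_le measurable_front[OF x, of p "\<lambda>U. U \<noteq> {} \<and> card U \<le> N"] measurable_front[OF x, of p "\<lambda>U. N < card U"])
  finally have "q / 2 \<le> \<P>(\<omega> in ?M. N < card (?F \<omega>))" using small by simp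
  then have "real N * (q / 2) \<le> real N * \<P>(\<omega> in ?M. N < card (?F \<omega>))" by (intro mult_left_mono) auto
  also have "\<dots> = (\<Sum>U\<in>Pow (window R x n). real N * \<P>(\<omega> in ?M. ?F \<omega> = U \<and> N < card (?F \<omega>)))"
    unfolding sum_distrib_left[symmetric]
    by (rule arg_cong2[OF refl prob_front_partition[OF x measurable_front[OF x, where P = "\<lambda>U. N < card U"]]])
  also have "\<dots> \<le> (\<Sum>U\<in>Pow (window R x n). \<P>(\<omega> in ?M. ?F \<omega> = U) * card U)"
  proof (rule sum_mono)
    fix U
    show "real N * \<P>(\<omega> in ?M. ?F \<omega> = U \<and> N < card (?F \<omega>)) \<le> \<P>(\<omega> in ?M. ?F \<omega> = U) * card U"
    proof (cases "N < card U")
      case True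
      then have "{\<omega> \<in> space ?M. ?F \<omega> = U \<and> N < card (?F \<omega>)} = {\<omega> \<in> space ?M. ?F \<omega> = U}" by auto
      then show ?thesis using True by (simp add: mult.commute[of "real N"] mult_left_mono)
    next
      case False
      then have "{\<omega> \<in> space ?M. ?F \<omega> = U \<and> N < card (?F \<omega>)} = {}" by auto
      then show ?thesis by (simp only: measure_empty) simp
    qed
  qed
  also have "\<dots> = (\<Sum>w\<in>window R x n. \<P>(\<omega> in ?M. reach (edges_in (block x n)) \<omega> v w))"
    unfolding front_def
    by (rule sum_prob_eq_sum_card[OF finite_window[OF x] finite_edges_block[OF x] edges_in_sub depends_on_reach, symmetric])
  finally show ?thesis using n by blast
qed

text \<open>Force open the tree paths from \<open>x\<close> down to \<open>v\<close> and from \<open>w\<close> down to \<open>y\<close>, at most \<open>t + R\<close> edges.\<close>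

lemma prob_link_ge:
  assumes p: "0 \<le> p" "p \<le> 1" and x: "x \<in> V" and v: "v \<in> level x t" "t \<le> n"
    and w: "w \<in> level x k" "k \<le> n" "n < k + R" and y: "y \<in> level w (n - k)"
  shows "p ^ (t + R) * \<P>(\<omega> in percolation E p. reach (edges_in (block x n)) \<omega> v w)
    \<le> \<P>(\<omega> in percolation E p. link x n y \<omega>)"
proof -
  let ?M = "percolation E p" and ?F = "edges_in (block x n)" and ?G = "up v t \<union> up y (n - k)"
  interpret prob_space ?M by (rule prob_space_percolation)
  have "up v t \<subseteq> edges_in (block x (0 + t))" using v x by (intro up_edges[of v x]) (auto simp: level_0)
  also have "\<dots> \<subseteq> ?F" using v by (intro edges_in_mono block_mono) auto
  finally have G1: "up v t \<subseteq> ?F" .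
  have G2: "up y (n - k) \<subseteq> ?F" using up_edges[OF y w(1)] w by simp
  have "card ?G \<le> t + (n - k)" using card_Un_le[of "up v t" "up y (n - k)"] card_up_le[of v t] card_up_le[of y "n - k"] by linarith
  then have "card ?G \<le> t + R" using w by linarith
  then have "p ^ (t + R) * \<P>(\<omega> in ?M. reach ?F \<omega> v w) \<le> p ^ card ?G * \<P>(\<omega> in ?M. reach ?F \<omega> v w)"
    using p by (intro mult_right_mono power_decreasing) auto
  also have "\<dots> \<le> \<P>(\<omega> in ?M. reach ?F \<omega> v w \<and> (\<forall>e\<in>?G. \<omega> e))"
    using G1 G2 p
    by (intro prob_insert_open[OF finite_edges_block[OF x] edges_in_sub depends_on_reach]) (auto elim: reach_mono)
  also have "\<dots> \<le> \<P>(\<omega> in ?M. link x n y \<omega>)"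
  proof (rule finite_measure_mono)
    show "{\<omega> \<in> space ?M. reach ?F \<omega> v w \<and> (\<forall>e\<in>?G. \<omega> e)} \<subseteq> {\<omega> \<in> space ?M. link x n y \<omega>}"
    proof
      fix \<omega> assume "\<omega> \<in> {\<omega> \<in> space ?M. reach ?F \<omega> v w \<and> (\<forall>e\<in>?G. \<omega> e)}"
      then have \<omega>: "\<omega> \<in> space ?M" "reach ?F \<omega> v w" "\<forall>e\<in>up v t. \<omega> e" "\<forall>e\<in>up y (n - k). \<omega> e" by auto
      have "reach ?F \<omega> v x" using reach_up[OF \<omega>(3) G1] v by (simp add: level_def)
      moreover have "reach ?F \<omega> y w" using reach_up[OF \<omega>(4) G2] y by (simp add: level_def)
      ultimately have "reach ?F \<omega> x y" using \<omega>(2) by (blast intro: reach_trans reach_sym)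
      then show "\<omega> \<in> {\<omega> \<in> space ?M. link x n y \<omega>}" using \<omega> by (simp add: link_def)
    qed
  qed (rule measurable_link[OF x])
  finally show ?thesis .
qed

text \<open>
  Each vertex of the window is sent to a descendant at depth \<open>n\<close>. This map is injective on each of
  the at most \<open>R\<close> levels of the window, whence the factor \<open>R\<close>.
\<close>

lemma sum_window_le:
  assumes p: "0 \<le> p" "p \<le> 1" and x: "x \<in> V" and v: "v \<in> level x t" "t \<le> n"
  shows "p ^ (t + R) * (\<Sum>w\<in>window R x n. \<P>(\<omega> in percolation E p. reach (edges_in (block x n)) \<omega> v w))
    \<le> real R * mean x n p"
proof -
  let ?M = "percolation E p" and ?K = "{k. k \<le> n \<and> n < k + R}"
  let ?f = "\<lambda>w. \<P>(\<omega> in ?M. reach (edges_in (block x n)) \<omega> v w)"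
  have K: "finite ?K" "card ?K \<le> R"
  proof -
    have "?K \<subseteq> (\<lambda>i. n - i) ` {..<R}"
    proof
      fix k assume "k \<in> ?K"
      then show "k \<in> (\<lambda>i. n - i) ` {..<R}" by (intro image_eqI[of _ _ "n - k"]) auto
    qed
    then show "finite ?K" "card ?K \<le> R"
      using finite_subset surj_card_le[of "{..<R}" ?K "\<lambda>i. n - i"] by auto
  qed
  have level_le: "p ^ (t + R) * (\<Sum>w\<in>level x k. ?f w) \<le> mean x n p" if k: "k \<in> ?K" for k
  proof -
    have "\<exists>y. y \<in> level w (n - k)" if "w \<in> level x k" for w
    proof -
      have "w \<in> V" using that level_in_V by auto
      then have "card (level w (n - k)) \<noteq> 0" using d by (simp add: card_level)
      then show ?thesis by (metis card.empty ex_in_conv)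
    qed
    then obtain g where g: "\<And>w. w \<in> level x k \<Longrightarrow> g w \<in> level w (n - k)" by metis
    have inj: "inj_on g (level x k)" using g by (intro inj_onI) (metis (mono_tags, lifting) level_def mem_Collect_eq)
    have sub: "g ` level x k \<subseteq> level x n" using level_add g k by force
    have "p ^ (t + R) * (\<Sum>w\<in>level x k. ?f w) = (\<Sum>w\<in>level x k. p ^ (t + R) * ?f w)"
      by (rule sum_distrib_left)
    also have "\<dots> \<le> (\<Sum>w\<in>level x k. \<P>(\<omega> in ?M. link x n (g w) \<omega>))"
      using k g by (intro sum_mono prob_link_ge[OF p x v]) auto
    also have "\<dots> = (\<Sum>y\<in>g ` level x k. \<P>(\<omega> in ?M. link x n y \<omega>))" by (simp add: sum.reindex[OF inj])
    also have "\<dots> \<le> mean x n p"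
      unfolding mean_def by (intro sum_mono2 finite_level[OF x] sub) auto
    finally show ?thesis .
  qed
  have "(\<Sum>w\<in>window R x n. ?f w) = (\<Sum>k\<in>?K. \<Sum>w\<in>level x k. ?f w)"
    unfolding window_def
    by (rule sum.UNION_disjoint) (use K finite_level[OF x] level_unique in \<open>blast+\<close>)
  then have "p ^ (t + R) * (\<Sum>w\<in>window R x n. ?f w) = (\<Sum>k\<in>?K. p ^ (t + R) * (\<Sum>w\<in>level x k. ?f w))"
    by (simp add: sum_distrib_left)
  also have "\<dots> \<le> (\<Sum>k\<in>?K. mean x n p)" by (rule sum_mono[OF level_le])
  also have "\<dots> = card ?K * mean x n p" by simp
  also have "\<dots> \<le> real R * mean x n p"
    using K unfolding mean_def by (intro mult_right_mono sum_nonneg) auto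
  finally show ?thesis .
qed

lemma positive_if_infinite:
  assumes "0 \<le> p" and pos: "\<P>(\<omega> in percolation E p. has_infinite_cluster V E \<omega>) > 0"
  shows "0 < p"
proof (rule ccontr)
  assume "\<not> 0 < p"
  then have p: "p = 0" using assms by simp
  let ?M = "percolation E 0"
  interpret prob_space ?M by (rule prob_space_percolation)
  have "AE \<omega> in ?M. \<not> \<omega> e" if e: "e \<in> E" for e
  proof -
    have "\<P>(\<omega> in ?M. \<omega> e) = 0" using prob_all_open[of "{e}" E 0] e by simp
    moreover have "{\<omega> \<in> space ?M. \<omega> e} \<in> sets ?M"
      using e by (intro measurable_depends_on[of "{e}"]) (auto intro: depends_onI)
    ultimately show ?thesis by (simp add: prob_Collect_eq_0)
  qed
  then have "AE \<omega> in ?M. \<forall>e\<in>E. \<not> \<omega> e" using countable_E by (simp add: AE_ball_countable)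
  then have "AE \<omega> in ?M. \<not> has_infinite_cluster V E \<omega>"
  proof eventually_elim
    case (elim \<omega>)
    have "y = x" if "reach E \<omega> x y" for x y
      using that by (induction rule: reach_induct) (use elim in auto)
    then have "{y. reach E \<omega> x y} \<subseteq> {x}" for x by auto
    then show ?case unfolding has_infinite_cluster_iff by (meson finite.emptyI finite_insert finite_subset)
  qed
  then have "\<P>(\<omega> in ?M. has_infinite_cluster V E \<omega>) = 0"
    using prob_Collect_eq_0[OF measurable_has_infinite_cluster] by blast
  then show False using pos p by simp
qed

theorem mean_of_infinite_cluster:
  assumes p: "0 < p" "p < 1" and pos: "\<P>(\<omega> in percolation E p. has_infinite_cluster V E \<omega>) > 0"
  shows "\<exists>x\<in>V. \<exists>n. 1 < mean x n p"
proof -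
  let ?M = "percolation E p"
  interpret prob_space ?M by (rule prob_space_percolation)
  obtain R where R: "edge_range R" using edges_short by blast
  have "\<exists>v\<in>V. \<P>(\<omega> in ?M. infinite {y. reach E \<omega> v y}) > 0"
  proof (rule ccontr)
    assume "\<not> ?thesis"
    then have "\<P>(\<omega> in ?M. infinite {y. reach E \<omega> v y}) = 0" if "v \<in> V" for v
      using that by (force simp: not_less measure_le_0_iff)
    then have "\<forall>v\<in>V. AE \<omega> in ?M. \<not> infinite {y. reach E \<omega> v y}"
      using prob_Collect_eq_0[OF measurable_infinite_cluster[OF subset_refl]] by blast
    then have "AE \<omega> in ?M. \<forall>v\<in>V. \<not> infinite {y. reach E \<omega> v y}"
      using countable_V by (simp add: AE_ball_countable)
    then have "AE \<omega> in ?M. \<not> has_infinite_cluster V E \<omega>" by (simp add: has_infinite_cluster_iff)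
    then have "\<P>(\<omega> in ?M. has_infinite_cluster V E \<omega>) = 0"
      using prob_Collect_eq_0[OF measurable_has_infinite_cluster] by blast
    then show False using pos by simp
  qed
  then obtain v where v: "v \<in> V" "\<P>(\<omega> in ?M. infinite {y. reach E \<omega> v y}) > 0" by blast
  obtain t where t: "\<P>(\<omega> in ?M. infinite {y. reach (edges_in (desc ((par ^^ t) v))) \<omega> v y}) > 0"
    using infinite_below[OF _ p(2) v] p by auto
  define x where "x = (par ^^ t) v"
  define q where "q = \<P>(\<omega> in ?M. infinite {y. reach (edges_in (desc x)) \<omega> v y})"
  have x: "x \<in> V" and vx: "v \<in> level x t" using v by (auto simp: x_def level_def funpow_par_in)
  have q: "0 < q" using t by (simp add: q_def x_def)
  have c: "0 < p ^ (t + R) * (q / 2)" using p q by simp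
  obtain N :: nat where N: "real R / (p ^ (t + R) * (q / 2)) < N" using reals_Archimedean2 by blast
  obtain n where n: "t \<le> n" "real N * (q / 2) \<le> (\<Sum>w\<in>window R x n. \<P>(\<omega> in ?M. reach (edges_in (block x n)) \<omega> v w))"
    using expected_front_large[OF _ p(2) R x vx q_def q, of N] p by auto
  have "real R * 1 < real N * (p ^ (t + R) * (q / 2))" using N c by (simp add: pos_divide_less_eq)
  also have "\<dots> = p ^ (t + R) * (real N * (q / 2))" by simp
  also have "\<dots> \<le> p ^ (t + R) * (\<Sum>w\<in>window R x n. \<P>(\<omega> in ?M. reach (edges_in (block x n)) \<omega> v w))"
    using n(2) p by (intro mult_left_mono) auto
  also have "\<dots> \<le> real R * mean x n p" using p by (intro sum_window_le[OF _ _ x vx n(1)]) auto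
  finally have "1 < mean x n p" by (rule mult_left_less_imp_less) simp
  then show ?thesis using x by blast
qed

lemma mean_gt_one_open:
  assumes p: "0 < p" "p \<le> 1" and x: "x \<in> V" "1 < mean x n p"
  shows "\<exists>p'. 0 \<le> p' \<and> p' < p \<and> 1 < mean x n p'"
proof -
  have "(mean x n \<longlongrightarrow> mean x n p) (at p within {0..1})"
    using continuous_mean[OF x(1)] p by (auto simp: continuous_on)
  then have "\<forall>\<^sub>F p' in at p within {0..1}. 1 < mean x n p'" using x(2) by (rule order_tendstoD(1))
  then obtain \<epsilon> where \<epsilon>: "0 < \<epsilon>" "\<And>p'. p' \<in> {0..1} \<Longrightarrow> p' \<noteq> p \<Longrightarrow> dist p' p < \<epsilon> \<Longrightarrow> 1 < mean x n p'"
    by (auto simp: eventually_at)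
  define p' where "p' = max 0 (p - \<epsilon> / 2)"
  have "0 \<le> p'" "p' < p" "dist p' p < \<epsilon>" using p \<epsilon>(1) by (auto simp: p'_def dist_real_def max_def)
  then show ?thesis using \<epsilon>(2)[of p'] p by (intro exI[of _ p']) auto
qed

text \<open>In particular \<open>mean x 1 1 > 1\<close>, which shows that the critical probability is less than 1.\<close>

lemma mean_one:
  assumes x: "x \<in> V" shows "mean x 1 1 = d"
proof -
  have "\<P>(\<omega> in percolation E 1. link x 1 y \<omega>) = 1" if y: "y \<in> level x 1" for y
  proof -
    interpret prob_space "percolation E 1" by (rule prob_space_percolation)
    have "x \<in> level x 0" using x by (simp add: level_0)
    then have "1 \<le> \<P>(\<omega> in percolation E 1. link x 1 y \<omega>)"
      using prob_link_ge[of 1 x x 0 1 x 0 2 y] x y by (simp add: prob_space)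
    then show ?thesis by (intro antisym prob_le_1)
  qed
  then show ?thesis unfolding mean_def using card_level[OF x, of 1] by simp
qed

theorem critical_no_infinite_cluster:
  "AE \<omega> in percolation E (critical_probability V E). \<not> has_infinite_cluster V E \<omega>"
proof -
  define S where "S = {p. 0 \<le> p \<and> p \<le> 1 \<and> \<P>(\<omega> in percolation E p. has_infinite_cluster V E \<omega>) = 1}"
  let ?pc = "critical_probability V E"
  have pc: "?pc = Inf S" by (simp add: critical_probability_def S_def)
  have bdd: "bdd_below S" by (rule bdd_belowI[of _ 0]) (simp add: S_def)
  have below: "\<exists>p'\<in>S. p' < p" if asm: "0 < p" "p \<le> 1" "x \<in> V" "1 < mean x n p" for p x n
  proof -
    obtain p' where p': "0 \<le> p'" "p' < p" "1 < mean x n p'" using mean_gt_one_open[OF asm] by blast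
    then have "p' \<in> S" using supercritical_of_mean[of p' x n] asm by (simp add: S_def)
    then show ?thesis using p' by blast
  qed
  obtain x0 where x0: "x0 \<in> V" using V_ne by auto
  obtain p1 where p1: "p1 \<in> S" "p1 < 1" using below[of 1 x0 1] x0 mean_one d by auto
  have "?pc \<le> p1" unfolding pc by (rule cInf_lower[OF p1(1) bdd])
  then have lt: "?pc < 1" using p1 by simp
  have ge: "0 \<le> ?pc" unfolding pc using p1(1) by (intro cInf_greatest) (blast, simp add: S_def)
  interpret prob_space "percolation E ?pc" by (rule prob_space_percolation)
  have "\<not> 0 < \<P>(\<omega> in percolation E ?pc. has_infinite_cluster V E \<omega>)"
  proof
    assume pos: "0 < \<P>(\<omega> in percolation E ?pc. has_infinite_cluster V E \<omega>)"
    then have "0 < ?pc" by (rule positive_if_infinite[OF ge])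
    moreover obtain x n where "x \<in> V" "1 < mean x n ?pc"
      using mean_of_infinite_cluster[OF \<open>0 < ?pc\<close> lt pos] by blast
    ultimately obtain p' where "p' \<in> S" "p' < ?pc" using below lt by force
    then show False using cInf_lower[OF _ bdd, of p'] unfolding pc by simp
  qed
  then have "\<P>(\<omega> in percolation E ?pc. has_infinite_cluster V E \<omega>) = 0"
    by (simp add: not_less measure_le_0_iff)
  then show ?thesis using prob_Collect_eq_0[OF measurable_has_infinite_cluster] by blast
qed

end

theorem theorem2p3:
  fixes V :: "'a set" and T E :: "'a set set" and d :: nat
    and \<xi> :: "(nat \<Rightarrow> 'a) set" and L :: "('a \<Rightarrow> 'a) set"
  assumes "d \<ge> 2"
    and "tree_graph V T" and "regular_graph V T (d + 1)"
    and "\<xi> \<in> graph_ends V T"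
    and "subgroup L (BijGroup V)" and "L \<subseteq> end_stabilizer V T \<xi>"
    and "vertex_transitive_on L V"
    and "decorated_tree V T L E"
  shows "AE \<omega> in percolation E (critical_probability V E). \<not> has_infinite_cluster V E \<omega>"
proof -
  interpret horocyclic_graph V E "end_parent \<xi>" d L
    by (rule decorated_tree_horocyclic[OF assms])
  show ?thesis by (rule critical_no_infinite_cluster)
qed

end
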